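(* For every constant $\delta>0$ there is $n_0$ such that for every $n\ge n_0$ there exists an instance of non-uniform BalancedEdge-Separator on at most $n$ vertices whose integrality gap with respect to the SDP relaxation (with triangle inequality constraints) described in the context is at least $(\log\log n)^{1/6-\delta}$.
   Context: An instance of non-uniform BalancedEdge-Separator consists of a complete undirected graph on a finite vertex set $V$, a weight ${\rm wt}(e)\ge 0$ and a demand ${\rm dem}(e)\ge 0$ on every edge $e$, and a balance parameter $B$ with $D/6\le B\le D/2$, where $D=\sum_e {\rm dem}(e)$. For $S\subseteq V$, $E(S,\overline S)$ is the set of edges with exactly one endpoint in $S$; a non-trivial cut $(S,\overline S)$ (i.e. $S\neq\emptyset,\overline S\neq\emptyset$) is $B'$-balanced if $\sum_{e\in E(S,\overline S)}{\rm dem}(e)\ge B'$. The SDP relaxation: minimize $\frac14\sum_{e\{x,y\}}{\rm wt}(e)\|v_x-v_y\|^2$ over vectors $v_x$ ($x\in V$) in a Euclidean space subject to $\|v_x\|^2=1$ for all $x$, $\|v_x-v_y\|^2+\|v_y-v_z\|^2\ge\|v_x-v_z\|^2$ for all $x,y,z\in V$, and $\frac14\sum_{e\{x,y\}}{\rm dem}(e)\|v_x-v_y\|^2\ge B$. If $\gamma$ is the SDP optimum and $\alpha$ is the minimum of $\sum_{e\in E(S,\overline S)}{\rm wt}(e)$ over all non-trivial $B/3$-balanced cuts, the integrality gap of the instance is $\alpha/\gamma$. *)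

theory Defs
  imports "HOL-Analysis.L2_Norm"
begin

record 'a separator_instance =
  verts :: "'a set"
  wt :: "'a set \<Rightarrow> real"
  dem :: "'a set \<Rightarrow> real"
  bal :: real

definition edges :: "'a set \<Rightarrow> 'a set set" where
  "edges V = {e. e \<subseteq> V \<and> card e = 2}"

definition total_dem :: "'a separator_instance \<Rightarrow> real" where
  "total_dem I = (\<Sum>e\<in>edges (verts I). dem I e)"

definition balanced_edge_separator :: "'a separator_instance \<Rightarrow> bool" where
  "balanced_edge_separator I \<longleftrightarrow>
     finite (verts I) \<and>
     (\<forall>e\<in>edges (verts I). wt I e \<ge> 0 \<and> dem I e \<ge> 0) \<and>
     total_dem I / 6 \<le> bal I \<and> bal I \<le> total_dem I / 2"

definition cut_edges :: "'a set \<Rightarrow> 'a set \<Rightarrow> 'a set set" where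
  "cut_edges V S = {e \<in> edges V. card (e \<inter> S) = 1}"

definition nontrivial_cut :: "'a set \<Rightarrow> 'a set \<Rightarrow> bool" where
  "nontrivial_cut V S \<longleftrightarrow> S \<subseteq> V \<and> S \<noteq> {} \<and> V - S \<noteq> {}"

definition balanced_cut :: "'a separator_instance \<Rightarrow> real \<Rightarrow> 'a set \<Rightarrow> bool" where
  "balanced_cut I b S \<longleftrightarrow>
     nontrivial_cut (verts I) S \<and> (\<Sum>e\<in>cut_edges (verts I) S. dem I e) \<ge> b"

text \<open>
  The minimum is over a nonempty set as soon as there are at least two vertices,
  because some non-trivial cut then separates at least half of the total demand.
\<close>
definition cut_opt :: "'a separator_instance \<Rightarrow> real" where
  "cut_opt I = Min {\<Sum>e\<in>cut_edges (verts I) S. wt I e | S. balanced_cut I (bal I / 3) S}"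

text \<open>
  The dimension of the Euclidean space is not fixed in advance, so a point of
  \<open>d\<close>-dimensional space is a function \<open>u :: nat \<Rightarrow> real\<close> of which only the
  coordinates \<open>i < d\<close> matter.
\<close>
definition sq_norm :: "nat \<Rightarrow> (nat \<Rightarrow> real) \<Rightarrow> real" where
  "sq_norm d u = (L2_set u {..<d})\<^sup>2"

definition sq_dist :: "nat \<Rightarrow> ('a \<Rightarrow> nat \<Rightarrow> real) \<Rightarrow> 'a \<Rightarrow> 'a \<Rightarrow> real" where
  "sq_dist d v x y = sq_norm d (\<lambda>i. v x i - v y i)"

definition edge_sq_dist :: "nat \<Rightarrow> ('a \<Rightarrow> nat \<Rightarrow> real) \<Rightarrow> 'a set \<Rightarrow> real" where
  "edge_sq_dist d v e = (THE r. \<exists>x y. e = {x, y} \<and> r = sq_dist d v x y)"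

lemma sq_dist_commute: "sq_dist d v x y = sq_dist d v y x"
  by (simp add: sq_dist_def sq_norm_def L2_set_def power2_commute)

lemma edge_sq_dist_doubleton [simp]: "edge_sq_dist d v {x, y} = sq_dist d v x y"
  unfolding edge_sq_dist_def
  by (rule the_equality) (auto simp: doubleton_eq_iff sq_dist_commute)

definition sdp_feasible :: "'a separator_instance \<Rightarrow> nat \<Rightarrow> ('a \<Rightarrow> nat \<Rightarrow> real) \<Rightarrow> bool" where
  "sdp_feasible I d v \<longleftrightarrow>
     (\<forall>x\<in>verts I. sq_norm d (v x) = 1) \<and>
     (\<forall>x\<in>verts I. \<forall>y\<in>verts I. \<forall>z\<in>verts I.
        sq_dist d v x y + sq_dist d v y z \<ge> sq_dist d v x z) \<and>
     1 / 4 * (\<Sum>e\<in>edges (verts I). dem I e * edge_sq_dist d v e) \<ge> bal I"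

definition sdp_objective :: "'a separator_instance \<Rightarrow> nat \<Rightarrow> ('a \<Rightarrow> nat \<Rightarrow> real) \<Rightarrow> real" where
  "sdp_objective I d v = 1 / 4 * (\<Sum>e\<in>edges (verts I). wt I e * edge_sq_dist d v e)"

definition sdp_opt :: "'a separator_instance \<Rightarrow> real" where
  "sdp_opt I = Inf {sdp_objective I d v | d v. sdp_feasible I d v}"

definition integrality_gap :: "'a separator_instance \<Rightarrow> real" where
  "integrality_gap I = cut_opt I / sdp_opt I"

end

theory Submission
  imports Defs
    "HOL-Analysis.Cartesian_Euclidean_Space"
    "HOL-Library.Nat_Bijection"
    "HOL-Real_Asymp.Real_Asymp"
begin

text \<open>
  The group \<open>\<int>\<^sub>2\<^sup>m\<close> acts on the \<open>N = 2\<^sup>m\<close> coordinates of the discrete cube, and the instance is essentially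
  the quotient of the cube by this action: the weights are the cube edges, together with very heavy weights
  inside the orbits and tiny weights everywhere, and the demands are uniform. A cut that respects the orbits
  is a balanced subset of the cube that is invariant under a transitive group of coordinate permutations, so
  all its influences agree, and by the theorem of Kahn, Kalai and Linial its edge boundary is at least a
  constant times \<open>m 2\<^sup>N\<close>.

  The squared distance of two points in the SDP solution is roughly \<open>2 - 2 K(x, y)\<close>, where \<open>K(x, y)\<close> sums a
  high power of the normalised overlaps of \<open>x\<close> with the shifts of \<open>y\<close>. For all but a tiny fraction of the
  points \<open>y\<close> the shifts of \<open>y\<close> are nearly orthogonal, so only the best shift matters, and the triangle
  inequality holds up to an error \<open>O(1/N)\<close>. This error is of the order of the distance of cube neighbours
  and is absorbed by one private coordinate per orbit. The SDP value is thus \<open>O(2\<^sup>N)\<close>, and the gap is of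
  order \<open>m\<close>, with \<open>2\<^sup>N = 2 ^ 2 ^ m\<close> bounding the number of vertices.
\<close>

section \<open>Fourier analysis on the discrete cube\<close>

text \<open>The natural similarity of two orbits, the best overlap over all shifts, need not be a
  Gram matrix. A sum over shifts of a high power of a Gram kernel is one, and the power makes the
  best shift dominate. Powers respect the triangle inequality: on the l1-type distance
  \<open>1 - rho\<close>, convexity gives (1-a)^p + (1-b)^p <= 1 + (1-a-b)^p, with a surplus of
  order ab. For tiny b this surplus cannot cover the contribution of the other shifts, hence the
  additive 1/N error. Points whose own shifts correlate too strongly are deleted; they are so few
  that the edge boundaries of cuts hardly shrink. Points rather than orbits serve as vertices, so
  the balance of a cut under uniform demands is a matter of cardinality. The heavy weights are free
  for the SDP, because all points of an orbit get the same vector. The tiny weights keep the SDP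
  value away from zero, so the gap is a genuine ratio.\<close>

definition sg :: "nat set \<Rightarrow> nat \<Rightarrow> real" where
  "sg x i = (if i \<in> x then -1 else 1)"

definition flip :: "nat \<Rightarrow> nat set \<Rightarrow> nat set" where
  "flip i x = (if i \<in> x then x - {i} else insert i x)"

definition walsh :: "nat set \<Rightarrow> nat set \<Rightarrow> real" where
  "walsh S x = (\<Prod>i\<in>S. sg x i)"

definition avg :: "nat \<Rightarrow> (nat set \<Rightarrow> real) \<Rightarrow> real" where
  "avg n f = (\<Sum>x\<in>Pow {..<n}. f x) / 2 ^ n"

lemma sg_sq [simp]: "sg x i * sg x i = 1" "(sg x i)\<^sup>2 = 1"
  by (auto simp: sg_def)

lemma abs_sg [simp]: "\<bar>sg x i\<bar> = 1"
  by (auto simp: sg_def)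

lemma flip_iff: "j \<in> flip i x \<longleftrightarrow> (if j = i then j \<notin> x else j \<in> x)"
  unfolding flip_def by (cases "i \<in> x") auto

lemma sg_flip: "sg (flip i x) j = (if j = i then - sg x j else sg x j)"
  unfolding sg_def flip_iff by simp

lemma flip_flip [simp]: "flip i (flip i x) = x"
  by (rule set_eqI) (simp add: flip_iff)

lemma flip_in_Pow [simp]: "i < n \<Longrightarrow> flip i x \<in> Pow {..<n} \<longleftrightarrow> x \<in> Pow {..<n}"
  unfolding flip_def by (cases "i \<in> x") auto

lemma walsh_empty [simp]: "walsh {} x = 1"
  by (simp add: walsh_def)

lemma walsh_sq [simp]: "walsh S x * walsh S x = 1"
  by (simp add: walsh_def prod.distrib[symmetric])

text \<open>Both sides are (-1) to the size of the intersection. This self-duality turns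
  orthogonality of the characters into the inversion formula \<open>fourier_expansion\<close>, with
  points and frequencies exchanged.\<close>

lemma walsh_commute:
  assumes "finite S" "finite x"
  shows "walsh S x = walsh x S"
proof -
  have *: "walsh S x = (-1) ^ card (S \<inter> x)" if "finite S" for S x
    unfolding walsh_def sg_def using that by (simp add: prod.If_cases Int_def)
  show ?thesis using assms by (simp add: * Int_commute)
qed

lemma walsh_flip:
  assumes "finite S"
  shows "walsh S (flip i x) = (if i \<in> S then - walsh S x else walsh S x)"
proof (cases "i \<in> S")
  case True
  have "walsh S y = sg y i * (\<Prod>j\<in>S-{i}. sg y j)" for y
    unfolding walsh_def using assms True by (rule prod.remove)
  moreover have "(\<Prod>j\<in>S-{i}. sg (flip i x) j) = (\<Prod>j\<in>S-{i}. sg x j)"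
    by (rule prod.cong) (auto simp: sg_flip)
  ultimately show ?thesis using True by (simp add: sg_flip)
next
  case False
  then show ?thesis unfolding walsh_def by (auto simp: sg_flip intro!: prod.cong)
qed

lemma walsh_mult:
  assumes "finite S" "finite T"
  shows "walsh S x * walsh T x = walsh (S - T \<union> (T - S)) x"
proof -
  have S: "walsh S x = walsh (S - T) x * walsh (S \<inter> T) x"
    unfolding walsh_def using prod.Int_Diff[OF assms(1), of "sg x" T] by simp
  have T: "walsh T x = walsh (T - S) x * walsh (S \<inter> T) x"
    unfolding walsh_def using prod.Int_Diff[OF assms(2), of "sg x" S] by (simp add: Int_commute)
  have "walsh (S - T \<union> (T - S)) x = walsh (S - T) x * walsh (T - S) x"
    unfolding walsh_def using assms by (intro prod.union_disjoint) auto
  moreover have "walsh S x * walsh T x = walsh (S - T) x * walsh (T - S) x * (walsh (S \<inter> T) x * walsh (S \<inter> T) x)"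
    unfolding S T by (simp only: ac_simps)
  ultimately show ?thesis by simp
qed

lemma avg_add: "avg n (\<lambda>x. f x + g x) = avg n f + avg n g"
  by (simp add: avg_def sum.distrib add_divide_distrib)

lemma avg_diff: "avg n (\<lambda>x. f x - g x) = avg n f - avg n g"
  by (simp add: avg_def sum_subtractf diff_divide_distrib)

lemma avg_cmult: "avg n (\<lambda>x. c * f x) = c * avg n f"
  by (simp add: avg_def sum_distrib_left)

lemma avg_sum: "avg n (\<lambda>x. \<Sum>i\<in>A. f i x) = (\<Sum>i\<in>A. avg n (f i))"
  unfolding avg_def by (subst sum.swap) (simp add: sum_divide_distrib)

lemma avg_const [simp]: "avg n (\<lambda>x. c) = c"
  by (simp add: avg_def card_Pow)

lemma avg_mono: "(\<And>x. x \<subseteq> {..<n} \<Longrightarrow> f x \<le> g x) \<Longrightarrow> avg n f \<le> avg n g"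
  unfolding avg_def by (intro divide_right_mono sum_mono) auto

lemma avg_nonneg: "(\<And>x. x \<subseteq> {..<n} \<Longrightarrow> 0 \<le> f x) \<Longrightarrow> 0 \<le> avg n f"
  using avg_mono[of n "\<lambda>x. 0" f] by simp

lemma avg_cong: "(\<And>x. x \<subseteq> {..<n} \<Longrightarrow> f x = g x) \<Longrightarrow> avg n f = avg n g"
  unfolding avg_def by (metis (mono_tags, lifting) Pow_iff sum.cong)

lemma avg_bij:
  assumes "bij_betw h (Pow {..<n}) (Pow {..<n})"
  shows "avg n (\<lambda>x. f (h x)) = avg n f"
  unfolding avg_def using sum.reindex_bij_betw[OF assms] by metis

lemma avg_flip:
  assumes "i < n"
  shows "avg n (\<lambda>x. f (flip i x)) = avg n f"
proof (rule avg_bij)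
  show "bij_betw (flip i) (Pow {..<n}) (Pow {..<n})"
    by (rule bij_betw_byWitness[where f' = "flip i"]) (use flip_in_Pow[OF assms] in \<open>auto simp del: Pow_iff\<close>)
qed

lemma avg_walsh:
  assumes "S \<subseteq> {..<n}"
  shows "avg n (walsh S) = (if S = {} then 1 else 0)"
proof (cases "S = {}")
  case True
  then have "walsh S = (\<lambda>x. 1)" by auto
  with True show ?thesis by simp
next
  case False
  then obtain i where i: "i \<in> S" by auto
  have "avg n (walsh S) = avg n (\<lambda>x. walsh S (flip i x))"
    using avg_flip[of i n "walsh S"] assms i by auto
  also have "\<dots> = avg n (\<lambda>x. (-1) * walsh S x)"
    using i assms finite_subset[OF assms] by (intro avg_cong) (simp add: walsh_flip)
  also have "\<dots> = - avg n (walsh S)" by (simp only: avg_cmult)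
  finally show ?thesis using False by simp
qed

lemma avg_walsh_mult:
  assumes "S \<subseteq> {..<n}" "T \<subseteq> {..<n}"
  shows "avg n (\<lambda>x. walsh S x * walsh T x) = (if S = T then 1 else 0)"
proof -
  have "finite S" "finite T" using assms finite_subset by auto
  then have "avg n (\<lambda>x. walsh S x * walsh T x) = avg n (walsh (S - T \<union> (T - S)))"
    by (simp add: walsh_mult)
  also have "\<dots> = (if S = T then 1 else 0)"
    using assms by (subst avg_walsh) auto
  finally show ?thesis .
qed

lemma avg_Cauchy_Schwarz: "(avg n (\<lambda>x. f x * g x))\<^sup>2 \<le> avg n (\<lambda>x. (f x)\<^sup>2) * avg n (\<lambda>x. (g x)\<^sup>2)"
proof -
  have "(\<Sum>x\<in>Pow {..<n}. f x * g x)\<^sup>2 \<le> (\<Sum>x\<in>Pow {..<n}. (f x)\<^sup>2) * (\<Sum>x\<in>Pow {..<n}. (g x)\<^sup>2)"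
    by (rule Cauchy_Schwarz_ineq_sum)
  from divide_right_mono[OF this, of "(2^n)\<^sup>2"]
  show ?thesis by (simp add: avg_def power_divide power2_eq_square)
qed

lemma avg_Suc: "avg (Suc n) f = avg n (\<lambda>x. (f x + f (insert n x)) / 2)"
proof -
  have "(\<Sum>x\<in>Pow {..<Suc n}. f x) = (\<Sum>x\<in>Pow {..<n}. f x) + (\<Sum>x\<in>insert n ` Pow {..<n}. f x)"
    unfolding lessThan_Suc Pow_insert by (rule sum.union_disjoint) auto
  also have "(\<Sum>x\<in>insert n ` Pow {..<n}. f x) = (\<Sum>x\<in>Pow {..<n}. f (insert n x))"
  proof (rule sum.reindex_cong[OF _ refl])
    show "inj_on (insert n) (Pow {..<n})"
      by (rule inj_onI) (metis PowD insert_ident lessThan_iff less_irrefl subsetD)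
  qed simp
  finally show ?thesis
    by (simp add: avg_def sum.distrib sum_divide_distrib[symmetric] add_divide_distrib[symmetric])
qed

section \<open>Low-degree polynomials and hypercontractivity\<close>

inductive lowdeg :: "nat \<Rightarrow> nat \<Rightarrow> (nat set \<Rightarrow> real) \<Rightarrow> bool" for n d where
  zero: "lowdeg n d (\<lambda>x. 0)"
| walsh: "S \<subseteq> {..<n} \<Longrightarrow> card S \<le> d \<Longrightarrow> lowdeg n d (\<lambda>x. c * walsh S x)"
| add: "lowdeg n d f \<Longrightarrow> lowdeg n d g \<Longrightarrow> lowdeg n d (\<lambda>x. f x + g x)"

lemma lowdeg_sum:
  "(\<And>a. a \<in> A \<Longrightarrow> lowdeg n d (f a)) \<Longrightarrow> lowdeg n d (\<lambda>x. \<Sum>a\<in>A. f a x)"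
  by (induction A rule: infinite_finite_induct) (simp_all add: lowdeg.zero lowdeg.add)

lemma card_sym_diff_le: "finite S \<Longrightarrow> finite T \<Longrightarrow> card (S - T \<union> (T - S)) \<le> card S + card T"
  by (rule order_trans[OF card_Un_le]) (intro add_mono card_mono, auto)

lemma lowdeg_mult_walsh:
  assumes S: "S \<subseteq> {..<n}" "card S \<le> d" and g: "lowdeg n e g"
  shows "lowdeg n (d + e) (\<lambda>x. c * walsh S x * g x)"
  using g
proof (induction rule: lowdeg.induct)
  case zero
  show ?case by (simp add: lowdeg.zero)
next
  case (walsh T c')
  have fin: "finite S" "finite T" using S walsh finite_subset by auto
  have "c * walsh S x * (c' * walsh T x) = (c * c') * walsh (S - T \<union> (T - S)) x" for x
    unfolding walsh_mult[OF fin, symmetric] by (simp only: ac_simps)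
  moreover have "card (S - T \<union> (T - S)) \<le> d + e"
    using card_sym_diff_le[OF fin] S walsh by linarith
  moreover have "S - T \<union> (T - S) \<subseteq> {..<n}" using S walsh by blast
  ultimately show ?case by (simp only: lowdeg.walsh)
next
  case (add g1 g2)
  have "lowdeg n (d + e) (\<lambda>x. c * walsh S x * g1 x + c * walsh S x * g2 x)"
    by (rule lowdeg.add[OF add.IH])
  then show ?case by (simp only: distrib_left)
qed

lemma lowdeg_mult:
  assumes f: "lowdeg n d f" and g: "lowdeg n e g"
  shows "lowdeg n (d + e) (\<lambda>x. f x * g x)"
  using f
proof (induction rule: lowdeg.induct)
  case zero
  show ?case by (simp add: lowdeg.zero)
next
  case (walsh S c)
  then show ?case using g by (rule lowdeg_mult_walsh)
next
  case (add f1 f2)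
  have "lowdeg n (d + e) (\<lambda>x. f1 x * g x + f2 x * g x)"
    by (rule lowdeg.add[OF add.IH])
  then show ?case by (simp only: distrib_right)
qed

text \<open>A multilinear polynomial is affine in its last sign, which is 1 off \<open>n\<close> and
  -1 after inserting \<open>n\<close>. Natural subtraction makes \<open>d - 1\<close> equal to 0 for
  constants too, so the vanishing of \<open>h\<close> for \<open>d = 0\<close> is recorded
  separately.\<close>

lemma lowdeg_Suc_split:
  assumes "lowdeg (Suc n) d f"
  shows "\<exists>g h. lowdeg n d g \<and> lowdeg n (d - 1) h \<and> (d = 0 \<longrightarrow> h = (\<lambda>x. 0)) \<and>
    (\<forall>x. x \<subseteq> {..<n} \<longrightarrow> f x = g x + h x \<and> f (insert n x) = g x - h x)"
    using assms
proof (induction rule: lowdeg.induct)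
  case zero
  show ?case by (rule exI[of _ "\<lambda>x. 0"], rule exI[of _ "\<lambda>x. 0"]) (simp add: lowdeg.zero)
next
  case (walsh S c)
  have fin: "finite S" using walsh finite_subset by auto
  have ins: "insert n x = flip n x" if "x \<subseteq> {..<n}" for x
    using that by (auto simp: flip_def)
  show ?case
  proof (cases "n \<in> S")
    case False
    with walsh have "S \<subseteq> {..<n}" by (metis lessThan_Suc subset_insert)
    then have "lowdeg n d (\<lambda>x. c * walsh S x)" using walsh by (intro lowdeg.walsh)
    then show ?thesis
      by - (rule exI[of _ "\<lambda>x. c * walsh S x"], rule exI[of _ "\<lambda>x. 0"],
          simp add: ins walsh_flip lowdeg.zero False fin)
  next
    case True
    have sub: "S - {n} \<subseteq> {..<n}" using walsh by auto
    have cd: "card (S - {n}) \<le> d - 1" using walsh True fin by simp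
    have "card S > 0" using True fin card_gt_0_iff by blast
    then have d0: "d \<noteq> 0" using walsh by linarith
    have "c * walsh S x = c * walsh (S - {n}) x" if "x \<subseteq> {..<n}" for x
      using that True fin by (subst (1) walsh_def, subst prod.remove[of _ n]) (auto simp: sg_def walsh_def)
    moreover have "lowdeg n (d - 1) (\<lambda>x. c * walsh (S - {n}) x)"
      using sub cd by (rule lowdeg.walsh)
    ultimately show ?thesis
      by - (rule exI[of _ "\<lambda>x. 0"], rule exI[of _ "\<lambda>x. c * walsh (S - {n}) x"],
          simp add: ins walsh_flip lowdeg.zero d0 fin True)
  qed
next
  case (add f1 f2)
  from add.IH obtain g1 h1 g2 h2 where
    "lowdeg n d g1" "lowdeg n (d - 1) h1" "d = 0 \<longrightarrow> h1 = (\<lambda>x. 0)"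
    "\<forall>x. x \<subseteq> {..<n} \<longrightarrow> f1 x = g1 x + h1 x \<and> f1 (insert n x) = g1 x - h1 x"
    "lowdeg n d g2" "lowdeg n (d - 1) h2" "d = 0 \<longrightarrow> h2 = (\<lambda>x. 0)"
    "\<forall>x. x \<subseteq> {..<n} \<longrightarrow> f2 x = g2 x + h2 x \<and> f2 (insert n x) = g2 x - h2 x"
    by (elim exE conjE)
  then show ?case
    by - (rule exI[of _ "\<lambda>x. g1 x + g2 x"], rule exI[of _ "\<lambda>x. h1 x + h2 x"], simp add: lowdeg.add)
qed

text \<open>Bonami's (2,4)-hypercontractive inequality. Averaging over the last sign kills the odd
  powers of \<open>h\<close>; the lower degree of \<open>h\<close> gains a factor 9, and the three
  remaining terms complete the square (A + B)^2.\<close>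

lemma bonami:
  assumes "lowdeg n d f"
  shows "avg n (\<lambda>x. f x ^ 4) \<le> 9 ^ d * (avg n (\<lambda>x. (f x)\<^sup>2))\<^sup>2"
  using assms
proof (induction n arbitrary: d f)
  case 0
  have "avg 0 (\<lambda>x. f x ^ 4) = (avg 0 (\<lambda>x. (f x)\<^sup>2))\<^sup>2"
    by (simp add: avg_def)
  moreover have "1 * (avg 0 (\<lambda>x. (f x)\<^sup>2))\<^sup>2 \<le> 9 ^ d * (avg 0 (\<lambda>x. (f x)\<^sup>2))\<^sup>2"
    by (intro mult_right_mono one_le_power) auto
  ultimately show ?case by simp
next
  case (Suc n)
  obtain g h where gh: "lowdeg n d g" "lowdeg n (d - 1) h" "d = 0 \<longrightarrow> h = (\<lambda>x. 0)"
    "\<forall>x. x \<subseteq> {..<n} \<longrightarrow> f x = g x + h x \<and> f (insert n x) = g x - h x"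
    using lowdeg_Suc_split[OF Suc.prems] by (elim exE conjE)
  define A where "A = avg n (\<lambda>x. (g x)\<^sup>2)"
  define B where "B = avg n (\<lambda>x. (h x)\<^sup>2)"
  have nn: "0 \<le> A" "0 \<le> B" unfolding A_def B_def by (auto intro: avg_nonneg)
  have e2: "avg (Suc n) (\<lambda>x. (f x)\<^sup>2) = A + B"
    unfolding avg_Suc A_def B_def avg_add[symmetric]
  proof (rule avg_cong)
    fix x assume x: "x \<subseteq> {..<n}"
    have "(a + b)\<^sup>2 + (a - b)\<^sup>2 = 2 * (a\<^sup>2 + b\<^sup>2)" for a b :: real
      by algebra
    then show "((f x)\<^sup>2 + (f (insert n x))\<^sup>2) / 2 = (g x)\<^sup>2 + (h x)\<^sup>2"
      using gh(4) x by simp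
  qed
  have e4: "avg (Suc n) (\<lambda>x. f x ^ 4)
      = avg n (\<lambda>x. g x ^ 4) + 6 * avg n (\<lambda>x. (g x)\<^sup>2 * (h x)\<^sup>2) + avg n (\<lambda>x. h x ^ 4)"
    unfolding avg_Suc avg_cmult[symmetric] avg_add[symmetric]
  proof (rule avg_cong)
    fix x assume x: "x \<subseteq> {..<n}"
    have "(a + b) ^ 4 + (a - b) ^ 4 = 2 * (a ^ 4 + 6 * (a\<^sup>2 * b\<^sup>2) + b ^ 4)" for a b :: real
      by algebra
    then show "(f x ^ 4 + f (insert n x) ^ 4) / 2 = g x ^ 4 + 6 * ((g x)\<^sup>2 * (h x)\<^sup>2) + h x ^ 4"
      using gh(4) x by simp
  qed
  have g4: "avg n (\<lambda>x. g x ^ 4) \<le> 9 ^ d * A\<^sup>2"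
    unfolding A_def by (rule Suc.IH[OF gh(1)])
  have h4: "9 * avg n (\<lambda>x. h x ^ 4) \<le> 9 ^ d * B\<^sup>2"
  proof (cases d)
    case 0
    then show ?thesis using gh(3) by simp
  next
    case (Suc d')
    then show ?thesis using Suc.IH[OF gh(2)] unfolding B_def by simp
  qed
  \<comment> \<open>The geometric mean of 9^d and 9^(d-1) is 9^d / 3, so the coefficient 6 of the
    cross term becomes the 2 of the binomial formula.\<close>
  have "(avg n (\<lambda>x. (g x)\<^sup>2 * (h x)\<^sup>2))\<^sup>2 \<le> avg n (\<lambda>x. g x ^ 4) * avg n (\<lambda>x. h x ^ 4)"
    using avg_Cauchy_Schwarz[of n "\<lambda>x. (g x)\<^sup>2" "\<lambda>x. (h x)\<^sup>2"] by simp
  also have "\<dots> \<le> (9 ^ d * A\<^sup>2) * (9 ^ d * B\<^sup>2 / 9)"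
    using g4 h4 by (intro mult_mono avg_nonneg) auto
  also have "\<dots> = (9 ^ d * A * B / 3)\<^sup>2"
    by (simp add: power2_eq_square)
  finally have gh2: "avg n (\<lambda>x. (g x)\<^sup>2 * (h x)\<^sup>2) \<le> 9 ^ d * A * B / 3"
    by (rule power2_le_imp_le) (use nn in auto)
  have "avg (Suc n) (\<lambda>x. f x ^ 4) \<le> 9 ^ d * A\<^sup>2 + 2 * (9 ^ d * A * B) + 9 ^ d * B\<^sup>2"
  proof -
    have "0 \<le> avg n (\<lambda>x. h x ^ 4)" by (auto intro: avg_nonneg)
    then show ?thesis unfolding e4 using g4 gh2 h4 by linarith
  qed
  also have "\<dots> = 9 ^ d * (avg (Suc n) (\<lambda>x. (f x)\<^sup>2))\<^sup>2"
    unfolding e2 by (simp add: power2_eq_square algebra_simps)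
  finally show ?case .
qed

section \<open>Fourier coefficients and influences\<close>

definition fourier :: "nat \<Rightarrow> (nat set \<Rightarrow> real) \<Rightarrow> nat set \<Rightarrow> real" where
  "fourier n f S = avg n (\<lambda>x. f x * walsh S x)"

lemma fourier_expansion:
  assumes "x \<subseteq> {..<n}"
  shows "f x = (\<Sum>S\<in>Pow {..<n}. fourier n f S * walsh S x)"
proof -
  have "(\<Sum>S\<in>Pow {..<n}. fourier n f S * walsh S x)
      = (\<Sum>S\<in>Pow {..<n}. \<Sum>y\<in>Pow {..<n}. f y * (walsh S y * walsh S x) / 2 ^ n)"
    by (simp add: fourier_def avg_def sum_distrib_right sum_divide_distrib mult.assoc)
  also have "\<dots> = (\<Sum>y\<in>Pow {..<n}. f y * ((\<Sum>S\<in>Pow {..<n}. walsh S y * walsh S x) / 2 ^ n))"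
    by (subst sum.swap) (simp add: sum_distrib_left sum_divide_distrib)
  also have "\<dots> = (\<Sum>y\<in>Pow {..<n}. f y * (if y = x then 1 else 0))"
  proof (intro sum.cong refl)
    fix y assume y: "y \<in> Pow {..<n}"
    have "(\<Sum>S\<in>Pow {..<n}. walsh S y * walsh S x) = (\<Sum>S\<in>Pow {..<n}. walsh y S * walsh x S)"
      using y assms by (intro sum.cong refl arg_cong2[where f = "(*)"] walsh_commute) (auto intro: finite_subset)
    then have "(\<Sum>S\<in>Pow {..<n}. walsh S y * walsh S x) / 2 ^ n = (if y = x then 1 else 0)"
      using avg_walsh_mult[of y n x] y assms unfolding avg_def by simp
    then show "f y * ((\<Sum>S\<in>Pow {..<n}. walsh S y * walsh S x) / 2 ^ n) = f y * (if y = x then 1 else 0)"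
      by simp
  qed
  also have "\<dots> = f x" using assms by (simp add: if_distrib cong: if_cong)
  finally show ?thesis by simp
qed

lemma avg_walsh_sum_sq:
  assumes "F \<subseteq> Pow {..<n}"
  shows "avg n (\<lambda>x. (\<Sum>S\<in>F. c S * walsh S x)\<^sup>2) = (\<Sum>S\<in>F. (c S)\<^sup>2)"
proof -
  have fin: "finite F" using assms finite_subset by auto
  have "avg n (\<lambda>x. (\<Sum>S\<in>F. c S * walsh S x)\<^sup>2)
      = avg n (\<lambda>x. \<Sum>S\<in>F. \<Sum>T\<in>F. (c S * c T) * (walsh S x * walsh T x))"
    by (simp add: power2_eq_square sum_product ac_simps)
  also have "\<dots> = (\<Sum>S\<in>F. \<Sum>T\<in>F. (c S * c T) * (if S = T then 1 else 0))"
    unfolding avg_sum avg_cmult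
    using assms by (intro sum.cong refl arg_cong2[where f = "(*)"] avg_walsh_mult) auto
  also have "\<dots> = (\<Sum>S\<in>F. (c S)\<^sup>2)"
    using fin by (simp add: power2_eq_square if_distrib cong: if_cong)
  finally show ?thesis .
qed

lemma parseval: "avg n (\<lambda>x. (f x)\<^sup>2) = (\<Sum>S\<in>Pow {..<n}. (fourier n f S)\<^sup>2)"
proof -
  have "avg n (\<lambda>x. (f x)\<^sup>2) = avg n (\<lambda>x. (\<Sum>S\<in>Pow {..<n}. fourier n f S * walsh S x)\<^sup>2)"
    by (rule avg_cong) (simp only: fourier_expansion[of _ n f, symmetric])
  then show ?thesis by (simp only: avg_walsh_sum_sq[OF order_refl])
qed

lemma fourier_deriv:
  assumes "i < n" "S \<subseteq> {..<n}"
  shows "fourier n (\<lambda>x. f x - f (flip i x)) S = (if i \<in> S then 2 * fourier n f S else 0)"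
proof -
  have fin: "finite S" using assms finite_subset by auto
  have "avg n (\<lambda>x. f (flip i x) * walsh S x) = avg n (\<lambda>x. f x * walsh S (flip i x))"
    using avg_flip[OF assms(1), of "\<lambda>x. f (flip i x) * walsh S x"] by simp
  also have "\<dots> = (if i \<in> S then - 1 else 1) * fourier n f S"
    unfolding fourier_def avg_cmult[symmetric] by (rule avg_cong) (use fin in \<open>auto simp: walsh_flip\<close>)
  finally show ?thesis
    unfolding fourier_def by (simp add: left_diff_distrib avg_diff)
qed

text \<open>Small support forces little weight on low levels. Cauchy-Schwarz and Bonami for the
  low-degree part \<open>g\<close> give \<tau>^(3/2) instead of the trivial \<tau>; the extra square
  root is what outweighs 3^d when \<open>kkl\<close> is applied.\<close>

lemma level_inequality:
  assumes D: "\<And>x. x \<subseteq> {..<n} \<Longrightarrow> D x \<in> {-1, 0, 1}"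
  defines "\<tau> \<equiv> avg n (\<lambda>x. (D x)\<^sup>2)"
  shows "(\<Sum>S | S \<subseteq> {..<n} \<and> card S \<le> d. (fourier n D S)\<^sup>2) \<le> 3 ^ d * (\<tau> * sqrt \<tau>)"
proof -
  define F where "F = {S. S \<subseteq> {..<n} \<and> card S \<le> d}"
  define g where "g x = (\<Sum>S\<in>F. fourier n D S * walsh S x)" for x
  define W where "W = (\<Sum>S\<in>F. (fourier n D S)\<^sup>2)"
  have FP: "F \<subseteq> Pow {..<n}" by (auto simp: F_def)
  have g2: "avg n (\<lambda>x. (g x)\<^sup>2) = W"
    unfolding g_def W_def by (rule avg_walsh_sum_sq[OF FP])
  have gD: "avg n (\<lambda>x. g x * D x) = W"
  proof -
    have "avg n (\<lambda>x. g x * D x) = avg n (\<lambda>x. \<Sum>S\<in>F. fourier n D S * (D x * walsh S x))"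
      unfolding g_def sum_distrib_right by (simp only: ac_simps)
    also have "\<dots> = W"
      unfolding avg_sum avg_cmult W_def by (simp add: fourier_def power2_eq_square)
    finally show ?thesis .
  qed
  have nn: "0 \<le> \<tau>" "0 \<le> W" unfolding \<tau>_def W_def by (auto intro: avg_nonneg sum_nonneg)
  have ld: "lowdeg n d g"
    unfolding g_def by (rule lowdeg_sum, rule lowdeg.walsh) (auto simp: F_def)
  have D4: "D x ^ 4 = (D x)\<^sup>2" "(D x)\<^sup>2 * D x = D x" if "x \<subseteq> {..<n}" for x
    using D[OF that] by auto
  \<comment> \<open>Since D^3 = D, a factor D^2 can be inserted; it confines \<open>g\<close> to the
    support of \<open>D\<close> before Cauchy-Schwarz is applied, which yields the extra root of
    \<tau>.\<close>
  have gD2: "avg n (\<lambda>x. (g x * (D x)\<^sup>2) * D x) = W"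
  proof -
    have "avg n (\<lambda>x. (g x * (D x)\<^sup>2) * D x) = avg n (\<lambda>x. g x * D x)"
    proof (rule avg_cong)
      fix x assume "x \<subseteq> {..<n}"
      from D4(2)[OF this] show "g x * (D x)\<^sup>2 * D x = g x * D x"
        by (simp only: mult.assoc)
    qed
    then show ?thesis using gD by (rule trans)
  qed
  have "W\<^sup>2 = (avg n (\<lambda>x. (g x * (D x)\<^sup>2) * D x))\<^sup>2"
    by (simp only: gD2)
  also have "\<dots> \<le> avg n (\<lambda>x. (g x * (D x)\<^sup>2)\<^sup>2) * \<tau>"
    unfolding \<tau>_def by (rule avg_Cauchy_Schwarz)
  also have "avg n (\<lambda>x. (g x * (D x)\<^sup>2)\<^sup>2) = avg n (\<lambda>x. (g x)\<^sup>2 * (D x)\<^sup>2)"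
    by (rule avg_cong) (simp add: power_mult_distrib D4)
  also have "\<dots> \<le> 3 ^ d * W * sqrt \<tau>"
  proof (rule power2_le_imp_le)
    have "(avg n (\<lambda>x. (g x)\<^sup>2 * (D x)\<^sup>2))\<^sup>2 \<le> avg n (\<lambda>x. ((g x)\<^sup>2)\<^sup>2) * avg n (\<lambda>x. ((D x)\<^sup>2)\<^sup>2)"
      by (rule avg_Cauchy_Schwarz)
    also have "avg n (\<lambda>x. ((D x)\<^sup>2)\<^sup>2) = \<tau>"
      unfolding \<tau>_def by (rule avg_cong) (simp add: D4)
    also have "avg n (\<lambda>x. ((g x)\<^sup>2)\<^sup>2) * \<tau> \<le> (9 ^ d * W\<^sup>2) * \<tau>"
      using bonami[OF ld] nn unfolding g2 by (intro mult_right_mono) auto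
    also have "\<dots> = (3 ^ d * W * sqrt \<tau>)\<^sup>2"
    proof -
      have "((3::real) ^ d)\<^sup>2 = 9 ^ d"
        by (simp add: power2_eq_square power_mult_distrib[symmetric])
      then show ?thesis
        using nn by (simp add: power_mult_distrib)
    qed
    finally show "(avg n (\<lambda>x. (g x)\<^sup>2 * (D x)\<^sup>2))\<^sup>2 \<le> (3 ^ d * W * sqrt \<tau>)\<^sup>2" .
  qed (use nn in auto)
  finally have "W * W \<le> W * (3 ^ d * (\<tau> * sqrt \<tau>))"
    using nn by (auto simp: power2_eq_square mult_right_mono ac_simps)
  then have "W \<le> 3 ^ d * (\<tau> * sqrt \<tau>)"
    using nn by (cases "W = 0") (auto simp: mult_le_cancel_left)
  then show ?thesis by (simp add: W_def F_def)
qed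

text \<open>The weight on levels above \<open>d\<close> is at most the total influence divided by \<open>d + 1\<close>;
  hypercontractivity bounds the weight on the levels below.\<close>
lemma kkl:
  fixes S :: "nat set set"
  assumes "\<And>i. i < n \<Longrightarrow> avg n (\<lambda>x. of_bool ((x \<in> S) \<noteq> (flip i x \<in> S))) = \<tau>"
  defines "\<mu> \<equiv> avg n (\<lambda>x. of_bool (x \<in> S))"
  shows "4 * (\<mu> - \<mu>\<^sup>2) \<le> real n * (3 ^ d * (\<tau> * sqrt \<tau>)) + real n * \<tau> / (real d + 1)"
proof -
  define f where "f x = (of_bool (x \<in> S) :: real)" for x
  define D where "D i x = f x - f (flip i x)" for i x
  define w where "w T = (fourier n f T)\<^sup>2" for T
  define P where "P = Pow {..<n}"
  have finP: "finite P" by (simp add: P_def)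
  have finT: "finite T" if "T \<in> P" for T using that finite_subset by (auto simp: P_def)
  have w0: "0 \<le> w T" for T by (simp add: w_def)
  have D2: "avg n (\<lambda>x. (D i x)\<^sup>2) = \<tau>" if "i < n" for i
    unfolding assms(1)[OF that, symmetric] by (rule avg_cong) (auto simp: D_def f_def)
  have fD: "(fourier n (D i) T)\<^sup>2 = (if i \<in> T then 4 * w T else 0)" if "i < n" "T \<in> P" for i T
    using fourier_deriv[of i n T f] that unfolding D_def w_def P_def by (auto simp: power_mult_distrib)
  have cnt: "(\<Sum>i<n. \<Sum>T\<in>Q. (fourier n (D i) T)\<^sup>2) = (\<Sum>T\<in>Q. 4 * real (card T) * w T)" if "Q \<subseteq> P" for Q
  proof -
    have "(\<Sum>i<n. \<Sum>T\<in>Q. (fourier n (D i) T)\<^sup>2) = (\<Sum>i<n. \<Sum>T\<in>Q. (if i \<in> T then 4 * w T else 0))"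
      using that by (intro sum.cong refl fD) auto
    also have "\<dots> = (\<Sum>T\<in>Q. \<Sum>i<n. (if i \<in> T then 4 * w T else 0))"
      by (rule sum.swap)
    also have "\<dots> = (\<Sum>T\<in>Q. 4 * real (card T) * w T)"
    proof (intro sum.cong refl)
      fix T assume "T \<in> Q"
      then have "{..<n} \<inter> T = T" using that by (auto simp: P_def)
      then show "(\<Sum>i<n. (if i \<in> T then 4 * w T else 0)) = 4 * real (card T) * w T"
        by (simp add: sum.If_cases)
    qed
    finally show ?thesis .
  qed
  have tot: "(\<Sum>T\<in>P. 4 * real (card T) * w T) = real n * \<tau>"
    unfolding cnt[OF order_refl, symmetric] using D2 parseval[of n "D i" for i] by (simp add: P_def)
  have low: "(\<Sum>T | T \<in> P \<and> card T \<le> d. 4 * real (card T) * w T) \<le> real n * (3 ^ d * (\<tau> * sqrt \<tau>))"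
  proof -
    have "(\<Sum>i<n. \<Sum>T | T \<in> P \<and> card T \<le> d. (fourier n (D i) T)\<^sup>2) \<le> (\<Sum>i<n. 3 ^ d * (\<tau> * sqrt \<tau>))"
    proof (intro sum_mono)
      fix i assume "i \<in> {..<n}"
      then show "(\<Sum>T | T \<in> P \<and> card T \<le> d. (fourier n (D i) T)\<^sup>2) \<le> 3 ^ d * (\<tau> * sqrt \<tau>)"
        using level_inequality[of n "D i" d] D2[of i] by (simp add: P_def D_def f_def)
    qed
    then show ?thesis by (subst cnt[symmetric]) (auto simp: Collect_conj_eq)
  qed
  have high: "(\<Sum>T | T \<in> P \<and> \<not> card T \<le> d. 4 * w T) \<le> real n * \<tau> / (real d + 1)"
  proof -
    have "(real d + 1) * (\<Sum>T | T \<in> P \<and> \<not> card T \<le> d. 4 * w T)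
        \<le> (\<Sum>T | T \<in> P \<and> \<not> card T \<le> d. 4 * real (card T) * w T)"
      unfolding sum_distrib_left
    proof (rule sum_mono)
      fix T assume "T \<in> {T \<in> P. \<not> card T \<le> d}"
      then have "real d + 1 \<le> real (card T)" by auto
      then have "(real d + 1) * (4 * w T) \<le> real (card T) * (4 * w T)"
        using w0 by (intro mult_right_mono) auto
      then show "(real d + 1) * (4 * w T) \<le> 4 * real (card T) * w T" by simp
    qed
    also have "\<dots> \<le> real n * \<tau>"
      unfolding tot[symmetric] by (rule sum_mono2) (use finP w0 in auto)
    finally show ?thesis by (simp add: field_simps)
  qed
  have "\<mu> = (\<Sum>T\<in>P. w T)"
    unfolding \<mu>_def w_def P_def parseval[symmetric] by (rule avg_cong) (auto simp: f_def)
  moreover have "w {} = \<mu>\<^sup>2" by (simp add: w_def fourier_def \<mu>_def f_def)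
  ultimately have "\<mu> - \<mu>\<^sup>2 = (\<Sum>T\<in>P - {{}}. w T)"
    using finP by (subst sum_diff1) (auto simp: P_def)
  then have "4 * (\<mu> - \<mu>\<^sup>2) = (\<Sum>T\<in>P - {{}}. 4 * w T)"
    by (simp add: sum_distrib_left)
  also have "\<dots> = (\<Sum>T | T \<in> P - {{}} \<and> card T \<le> d. 4 * w T) + (\<Sum>T | T \<in> P - {{}} \<and> \<not> card T \<le> d. 4 * w T)"
    using finP by (subst sum.union_disjoint[symmetric]) (auto intro!: sum.cong)
  \<comment> \<open>Nonempty sets have size at least 1, so their weight may be multiplied by the
    size and thus compared with the influences.\<close>
  also have "(\<Sum>T | T \<in> P - {{}} \<and> card T \<le> d. 4 * w T) \<le> (\<Sum>T | T \<in> P - {{}} \<and> card T \<le> d. 4 * real (card T) * w T)"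
  proof (rule sum_mono)
    fix T assume "T \<in> {T \<in> P - {{}}. card T \<le> d}"
    then have "card T \<noteq> 0" using finT by auto
    then have "1 * (4 * w T) \<le> real (card T) * (4 * w T)" using w0 by (intro mult_right_mono) auto
    then show "4 * w T \<le> 4 * real (card T) * w T" by simp
  qed
  also have "\<dots> \<le> (\<Sum>T | T \<in> P \<and> card T \<le> d. 4 * real (card T) * w T)"
    by (rule sum_mono2) (use finP w0 in auto)
  also have "(\<Sum>T | T \<in> P - {{}} \<and> \<not> card T \<le> d. 4 * w T) = (\<Sum>T | T \<in> P \<and> \<not> card T \<le> d. 4 * w T)"
    by (rule sum.cong) auto
  finally show ?thesis using low high by linarith
qed

section \<open>The triangle inequality for overlaps\<close>

text \<open>The bound involves powers of \<open>a\<close> only, because the overlaps that will play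
  the role of \<open>c\<close> come without control of their power sums. For c > a the left side is
  negative.\<close>

lemma power_diff_le:
  fixes a c :: real
  assumes "0 \<le> a" "0 \<le> c" "\<bar>a - c\<bar> \<le> \<delta>"
  shows "a ^ Suc n - c ^ Suc n \<le> real (Suc n) * \<delta> * a ^ n"
proof (cases "c \<le> a")
  case True
  have "a ^ Suc n - c ^ Suc n = (a - c) * (\<Sum>p<Suc n. a ^ p * c ^ (n - p))"
    by (rule diff_power_eq_sum)
  also have "\<dots> \<le> \<delta> * (\<Sum>p<Suc n. a ^ n)"
  proof (intro mult_mono sum_mono)
    fix p assume "p \<in> {..<Suc n}"
    then have "a ^ n = a ^ p * a ^ (n - p)" by (simp add: power_add[symmetric])
    then show "a ^ p * c ^ (n - p) \<le> a ^ n"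
      using True assms by (simp add: mult_left_mono power_mono)
  qed (use assms in \<open>auto intro!: sum_nonneg simp del: sum.lessThan_Suc\<close>)
  finally show ?thesis by (simp add: mult.commute mult.left_commute)
next
  case False
  then have "a ^ Suc n \<le> c ^ Suc n" using assms by (intro power_mono) auto
  moreover have "0 \<le> real (Suc n) * \<delta> * a ^ n" using assms by auto
  ultimately show ?thesis by linarith
qed

text \<open>Equality holds for exponent 2. Raising the exponent only lowers the left side, since
  a(1-a)^k + b(1-b)^k >= (a+b)(1-a-b)^k. The surplus 2ab is what the triangle inequality has to
  spend.\<close>

lemma power_cross_difference:
  fixes a b :: real
  assumes "0 \<le> a" "0 \<le> b" "a + b \<le> 1"
  shows "(1 - a) ^ (n + 2) + (1 - b) ^ (n + 2) - (1 - a - b) ^ (n + 2) \<le> 1 - 2 * a * b"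
proof (induction n)
  case 0
  show ?case by (simp add: power2_eq_square algebra_simps)
next
  case (Suc n)
  let ?k = "n + 2"
  have "(1 - a - b) ^ ?k \<le> (1 - a) ^ ?k" "(1 - a - b) ^ ?k \<le> (1 - b) ^ ?k"
    using assms by (intro power_mono; simp)+
  then have "a * (1 - a - b) ^ ?k + b * (1 - a - b) ^ ?k \<le> a * (1 - a) ^ ?k + b * (1 - b) ^ ?k"
    using assms by (intro add_mono mult_left_mono) auto
  moreover have "(1 - a) ^ (Suc n + 2) = (1 - a) ^ ?k - a * (1 - a) ^ ?k"
    "(1 - b) ^ (Suc n + 2) = (1 - b) ^ ?k - b * (1 - b) ^ ?k"
    "(1 - a - b) ^ (Suc n + 2) = (1 - a - b) ^ ?k - a * (1 - a - b) ^ ?k - b * (1 - a - b) ^ ?k"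
    by (simp_all add: left_diff_distrib)
  ultimately show ?case using Suc.IH by linarith
qed

lemma sum_power_le:
  fixes f :: "'a \<Rightarrow> real"
  assumes "\<And>s. s \<in> S \<Longrightarrow> 0 \<le> f s \<and> f s \<le> c" "k \<le> n"
  shows "(\<Sum>s\<in>S. f s ^ n) \<le> c ^ (n - k) * (\<Sum>s\<in>S. f s ^ k)"
  unfolding sum_distrib_left
proof (rule sum_mono)
  fix s assume s: "s \<in> S"
  have "f s ^ n = f s ^ (n - k) * f s ^ k" using assms(2) by (simp add: power_add[symmetric])
  also have "\<dots> \<le> c ^ (n - k) * f s ^ k"
    using assms(1)[OF s] by (intro mult_right_mono power_mono) auto
  finally show "f s ^ n \<le> c ^ (n - k) * f s ^ k" .
qed

lemma add_power4_le: "(a + b) ^ 4 \<le> 8 * (a ^ 4 + b ^ 4)" for a b :: real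
proof -
  have 2: "(u + v)\<^sup>2 \<le> 2 * (u\<^sup>2 + v\<^sup>2)" for u v :: real
    using zero_le_power2[of "u - v"] by (simp add: power2_eq_square algebra_simps)
  have "(a + b) ^ 4 = ((a + b)\<^sup>2)\<^sup>2" by simp
  also have "\<dots> \<le> (2 * (a\<^sup>2 + b\<^sup>2))\<^sup>2" by (intro power_mono 2) simp
  also have "\<dots> = 4 * (a\<^sup>2 + b\<^sup>2)\<^sup>2" by (simp only: power_mult_distrib) simp
  also have "\<dots> \<le> 4 * (2 * ((a\<^sup>2)\<^sup>2 + (b\<^sup>2)\<^sup>2))" by (intro mult_left_mono 2) simp
  finally show ?thesis by simp
qed

text \<open>The slope 4 has to outweigh a loss of slope 32/10 in
  \<open>overlap_triangle_aux\<close>. The eighth power already achieves it: multiply by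
  (1+\<delta>)^8 >= 1+8\<delta> and use (1-4\<delta>)(1+8\<delta>) >= 1, which holds exactly up to
  \<delta> = 1/8.\<close>

lemma one_minus_power32_le:
  fixes \<delta> :: real
  assumes "0 \<le> \<delta>" "\<delta> \<le> 1 / 8"
  shows "(1 - \<delta>) ^ 32 \<le> 1 - 4 * \<delta>"
proof -
  have "(1 - \<delta>) ^ 8 * (1 + 8 * \<delta>) \<le> (1 - \<delta>) ^ 8 * (1 + \<delta>) ^ 8"
    using Bernoulli_inequality[of \<delta> 8] assms by (intro mult_left_mono) auto
  also have "\<dots> = (1 - \<delta>\<^sup>2) ^ 8"
    by (simp add: power_mult_distrib[symmetric] power2_eq_square algebra_simps)
  also have "\<dots> \<le> 1" using assms by (intro power_le_one) (auto simp: power_le_one)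
  also have "1 \<le> (1 - 4 * \<delta>) * (1 + 8 * \<delta>)"
    using mult_left_mono[of \<delta> "1/8" \<delta>] assms by (simp add: algebra_simps)
  finally have "(1 - \<delta>) ^ 8 \<le> 1 - 4 * \<delta>"
    using assms by (simp add: mult_le_cancel_right)
  moreover have "(1 - \<delta>) ^ 32 \<le> (1 - \<delta>) ^ 8"
    using assms by (intro power_decreasing) auto
  ultimately show ?thesis by linarith
qed

text \<open>The case distinction is on whether the two best overlaps are at least \<open>7/8\<close>. The quadratic gain
  of \<open>power_cross_difference\<close> absorbs the contributions of the other overlaps.\<close>
lemma overlap_triangle_aux:
  fixes A B C \<theta> :: "'a \<Rightarrow> real"
  assumes S: "finite S" "o1 \<in> S"
    and A: "\<And>s. s \<in> S \<Longrightarrow> 0 \<le> A s \<and> A s \<le> A o1" "A o1 \<le> 1"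
    and B: "\<And>s. s \<in> S \<Longrightarrow> 0 \<le> B s \<and> B s \<le> B o1" "B o1 \<le> 1"
    and C: "\<And>s. s \<in> S \<Longrightarrow> 0 \<le> C s \<and> \<bar>A s - C s\<bar> \<le> 1 - B o1"
    and sums: "(\<Sum>s\<in>S. A s ^ 8) \<le> 1 + \<eta>" "(\<Sum>s\<in>S. B s ^ 8) \<le> 1 + \<eta>"
    and \<theta>: "\<And>s. s \<in> S - {o1} \<Longrightarrow> 0 \<le> \<theta> s \<and> \<theta> s ^ 4 \<le> \<eta> \<and> A s \<le> \<theta> s + (1 - A o1) \<and> B s \<le> \<theta> s + (1 - B o1)"
    and \<eta>: "0 \<le> \<eta>" "\<eta> \<le> 1 / 4096"
    and AB: "A o1 \<le> B o1"
  shows "(\<Sum>s\<in>S. A s ^ 32) + (\<Sum>s\<in>S. B s ^ 32) \<le> 1 + (\<Sum>s\<in>S. C s ^ 32) + 2 * \<eta>"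
proof -
  define a where "a = 1 - A o1"
  define b where "b = 1 - B o1"
  define S' where "S' = S - {o1}"
  have ab: "0 \<le> b" "b \<le> a" "a \<le> 1" using A B AB S unfolding a_def b_def by force+
  have split: "sum f S = f o1 + sum f S'" for f :: "'a \<Rightarrow> real"
    unfolding S'_def using S by (rule sum.remove)
  have C0: "0 \<le> (\<Sum>s\<in>S. C s ^ 32)" using C by (intro sum_nonneg) auto
  have tail8: "(\<Sum>s\<in>S'. f s ^ 8) \<le> \<eta> + 8 * (1 - f o1)"
    if "(\<Sum>s\<in>S. f s ^ 8) \<le> 1 + \<eta>" "0 \<le> f o1" for f
    using Bernoulli_inequality[of "- (1 - f o1)" 8] that by (simp add: split)
  have pow32: "(\<Sum>s\<in>S. f s ^ 32) \<le> (1 + \<eta>) / 2"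
    if "(\<Sum>s\<in>S. f s ^ 8) \<le> 1 + \<eta>" "\<And>s. s \<in> S \<Longrightarrow> 0 \<le> f s \<and> f s \<le> 7 / 8" for f
  proof -
    have "(\<Sum>s\<in>S. f s ^ 32) \<le> (7 / 8) ^ (32 - 8) * (\<Sum>s\<in>S. f s ^ 8)"
      by (rule sum_power_le) (use that in auto)
    also have "\<dots> \<le> (1 / 2) * (1 + \<eta>)"
      using that \<eta> by (intro mult_mono) (auto intro!: sum_nonneg simp: power_divide)
    finally show ?thesis by simp
  qed
  show ?thesis
  proof (cases "b \<ge> 1 / 8")
    case True
    \<comment> \<open>All overlaps of both families are at most 7/8, and (7/8)^24 is below 1/2. Each
      sum thus takes at most half of 1 + \<eta>, and \<open>C\<close> enters only through
      nonnegativity.\<close>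
    have "(\<Sum>s\<in>S. A s ^ 32) \<le> (1 + \<eta>) / 2"
      by (rule pow32[OF sums(1)]) (use A True ab in \<open>force simp: a_def\<close>)
    moreover have "(\<Sum>s\<in>S. B s ^ 32) \<le> (1 + \<eta>) / 2"
      by (rule pow32[OF sums(2)]) (use B True in \<open>force simp: b_def\<close>)
    moreover have "(1 + \<eta>) / 2 + (1 + \<eta>) / 2 \<le> 1 + 2 * \<eta>" using \<eta> by simp
    ultimately show ?thesis using C0 by linarith
  next
    case False
    then have b8: "b < 1 / 8" by simp
    \<comment> \<open>1/4096 is (1/8)^4, so the other self-overlaps are at most 1/8. This threshold
      is the origin of the bound \<open>12 \<le> m\<close> in \<open>ker_triangle\<close>.\<close>
    have \<theta>8: "\<theta> s \<le> 1 / 8" if "s \<in> S'" for s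
    proof (rule power_le_imp_le_base[where n = 3])
      have "\<theta> s ^ Suc 3 \<le> (1 / 8) ^ Suc 3"
        using \<theta>[of s] that \<eta> unfolding S'_def by (simp add: power_divide)
      then show "\<theta> s ^ Suc 3 \<le> (1 / 8) ^ Suc 3" .
    qed simp
    have eB: "(\<Sum>s\<in>S'. B s ^ 32) \<le> \<eta> + b\<^sup>2 / 1000"
    proof -
      \<comment> \<open>The exponent 32 is split as 20 + 4 + 8: since B <= 1/4, the first factor is
        negligible; the second is matched to the bound on \<theta>^4; the eighth powers are summed
        by \<open>tail8\<close>.\<close>
      have B24: "B s ^ 24 \<le> (\<eta> + b ^ 4) / 1000" if s: "s \<in> S'" for s
      proof -
        have 1: "0 \<le> B s" "B s \<le> \<theta> s + b" "0 \<le> \<theta> s" "\<theta> s ^ 4 \<le> \<eta>"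
          using \<theta>[of s] B(1)[of s] s unfolding S'_def b_def by auto
        have 2: "B s \<le> 1 / 4" using 1 \<theta>8[OF s] b8 by linarith
        have "B s ^ 24 = B s ^ 20 * B s ^ 4" by (simp add: power_add[symmetric])
        also have "\<dots> \<le> (1 / 4) ^ 20 * (\<theta> s + b) ^ 4"
          using 1 2 by (intro mult_mono power_mono) auto
        also have "\<dots> \<le> (1 / 4) ^ 20 * (8 * (\<theta> s ^ 4 + b ^ 4))"
          by (intro mult_left_mono add_power4_le) simp
        also have "\<dots> \<le> (1 / 4) ^ 20 * (8 * (\<eta> + b ^ 4))"
          using 1 by (intro mult_left_mono) auto
        also have "\<dots> = ((1 / 4) ^ 20 * 8) * (\<eta> + b ^ 4)" by simp
        also have "\<dots> \<le> (1 / 1000) * (\<eta> + b ^ 4)"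
          using \<eta> by (intro mult_right_mono) (auto simp: power_divide)
        finally show ?thesis by simp
      qed
      have "(\<Sum>s\<in>S'. B s ^ 32) \<le> (\<Sum>s\<in>S'. ((\<eta> + b ^ 4) / 1000) * B s ^ 8)"
      proof (rule sum_mono)
        fix s assume s: "s \<in> S'"
        have "B s ^ 32 = B s ^ 24 * B s ^ 8" by (simp add: power_add[symmetric])
        also have "\<dots> \<le> ((\<eta> + b ^ 4) / 1000) * B s ^ 8"
          using B24[OF s] B(1)[of s] s by (intro mult_right_mono) (auto simp: S'_def)
        finally show "B s ^ 32 \<le> ((\<eta> + b ^ 4) / 1000) * B s ^ 8" .
      qed
      also have "\<dots> = ((\<eta> + b ^ 4) / 1000) * (\<Sum>s\<in>S'. B s ^ 8)"
        by (simp add: sum_distrib_left)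
      also have "\<dots> \<le> ((\<eta> + b ^ 4) / 1000) * (\<eta> + 8 * b)"
        using tail8[OF sums(2)] B(1)[OF S(2)] \<eta> by (intro mult_left_mono) (auto simp: b_def)
      also have "\<dots> \<le> ((\<eta> + b ^ 4) / 1000) * 2"
        using \<eta> b8 by (intro mult_left_mono) auto
      also have "b ^ 4 \<le> b\<^sup>2 / 2"
      proof -
        have "b ^ 4 = b\<^sup>2 * b\<^sup>2" by (simp add: power_add[symmetric])
        also have "\<dots> \<le> b\<^sup>2 * (1 / 2)"
          using ab b8 power_mono[of b "1/8" 2] by (intro mult_left_mono) (auto simp: power_divide)
        finally show ?thesis by simp
      qed
      finally have "(\<Sum>s\<in>S'. B s ^ 32) \<le> (\<eta> + b\<^sup>2 / 2) / 1000 * 2"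
        by (simp add: divide_right_mono)
      then show ?thesis using \<eta> by simp
    qed
    have AC: "A s ^ 32 - C s ^ 32 \<le> 32 * b * A s ^ 31" if "s \<in> S" for s
      using power_diff_le[of "A s" "C s" b 31] A(1)[OF that] C[OF that] by (simp add: b_def)
    have b2: "b\<^sup>2 \<le> b / 8" using mult_left_mono[of b "1/8" b] ab b8 by (simp add: power2_eq_square)
    show ?thesis
    proof (cases "a \<ge> 1 / 8")
      case True
      \<comment> \<open>Here \<open>A\<close> has no overlap above 7/8, so passing from
        \<open>A\<close> to \<open>C\<close> costs at most 32b/10, and the drop 4b of the main term
        of \<open>B\<close> pays for it.\<close>
      have "(\<Sum>s\<in>S. A s ^ 31) \<le> (7 / 8) ^ (31 - 8) * (\<Sum>s\<in>S. A s ^ 8)"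
        by (rule sum_power_le) (use A True in \<open>force simp: a_def\<close>)+
      also have "\<dots> \<le> (1 / 20) * 2"
        using sums \<eta> A by (intro mult_mono) (auto intro!: sum_nonneg simp: power_divide)
      finally have A31: "(\<Sum>s\<in>S. A s ^ 31) \<le> 1 / 10" by simp
      have "(\<Sum>s\<in>S. A s ^ 32) - (\<Sum>s\<in>S. C s ^ 32) \<le> (\<Sum>s\<in>S. 32 * b * A s ^ 31)"
        unfolding sum_subtractf[symmetric] by (intro sum_mono AC)
      also have "\<dots> = 32 * b * (\<Sum>s\<in>S. A s ^ 31)" by (simp add: sum_distrib_left)
      also have "\<dots> \<le> 32 * b * (1 / 10)" using A31 ab by (intro mult_left_mono) auto
      finally have 1: "(\<Sum>s\<in>S. A s ^ 32) - (\<Sum>s\<in>S. C s ^ 32) \<le> 32 / 10 * b" by simp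
      have "B o1 ^ 32 \<le> 1 - 4 * b"
        using one_minus_power32_le[of b] ab b8 by (simp add: b_def)
      then have "(\<Sum>s\<in>S. B s ^ 32) \<le> 1 - 4 * b + (\<eta> + b\<^sup>2 / 1000)"
        using eB by (simp add: split)
      with 1 b2 ab \<eta> show ?thesis by linarith
    next
      case False
      then have a8: "a < 1 / 8" by simp
      have A4: "0 \<le> A s \<and> A s \<le> 1 / 4" if "s \<in> S'" for s
        using \<theta>[of s] \<theta>8[OF that] A(1)[of s] that a8 unfolding S'_def a_def by force
      have "(\<Sum>s\<in>S'. A s ^ 31) \<le> (1 / 4) ^ (31 - 8) * (\<Sum>s\<in>S'. A s ^ 8)"
        by (rule sum_power_le) (use A4 in auto)
      also have "\<dots> \<le> (1 / 4) ^ (31 - 8) * (\<eta> + 8 * a)"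
        using tail8[OF sums(1)] A(1)[OF S(2)] by (intro mult_left_mono) (auto simp: a_def)
      also have "\<dots> \<le> (1 / 1000) * (\<eta> + 8 * a)"
        using \<eta> ab by (intro mult_right_mono) (auto simp: power_divide)
      finally have A31: "(\<Sum>s\<in>S'. A s ^ 31) \<le> (\<eta> + 8 * a) / 1000" by simp
      have "(\<Sum>s\<in>S'. A s ^ 32) - (\<Sum>s\<in>S'. C s ^ 32) \<le> (\<Sum>s\<in>S'. 32 * b * A s ^ 31)"
        unfolding sum_subtractf[symmetric] by (intro sum_mono AC) (auto simp: S'_def)
      also have "\<dots> = 32 * b * (\<Sum>s\<in>S'. A s ^ 31)" by (simp add: sum_distrib_left)
      also have "\<dots> \<le> 32 * b * ((\<eta> + 8 * a) / 1000)" using A31 ab by (intro mult_left_mono) auto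
      also have "\<dots> = 32 / 1000 * (b * \<eta>) + 256 / 1000 * (a * b)" by (simp add: algebra_simps)
      finally have 1: "(\<Sum>s\<in>S'. A s ^ 32) - (\<Sum>s\<in>S'. C s ^ 32) \<le> 32 / 1000 * (b * \<eta>) + 256 / 1000 * (a * b)" .
      have b\<eta>: "b * \<eta> \<le> \<eta>" using \<eta> b8 by (intro mult_left_le_one_le) (use ab in auto)
      \<comment> \<open>This is where the order of the two best overlaps matters: the loss of order
        b^2 is charged to the surplus 2ab.\<close>
      have bb: "b\<^sup>2 \<le> a * b" using ab by (simp add: power2_eq_square mult_right_mono)
      have "(1 - a - b) ^ 32 \<le> C o1 ^ 32"
        using C[OF S(2)] a8 b8 by (intro power_mono) (auto simp: a_def b_def)
      moreover have "(1 - a) ^ 32 + (1 - b) ^ 32 - (1 - a - b) ^ 32 \<le> 1 - 2 * (a * b)"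
        using power_cross_difference[of a b 30] ab a8 b8 by simp
      ultimately have "(1 - a) ^ 32 + (1 - b) ^ 32 - C o1 ^ 32 \<le> 1 - 2 * (a * b)"
        by linarith
      then have "A o1 ^ 32 + B o1 ^ 32 - C o1 ^ 32 \<le> 1 - 2 * (a * b)"
        by (simp only: a_def b_def diff_diff_eq2 add_diff_cancel_left')
      moreover have "0 \<le> a * b" using ab by simp
      ultimately show ?thesis
        unfolding split[of "\<lambda>s. A s ^ 32"] split[of "\<lambda>s. B s ^ 32"] split[of "\<lambda>s. C s ^ 32"]
        using 1 eB b\<eta> bb \<eta> by linarith
    qed
  qed
qed

section \<open>The shift action, overlaps and their kernel\<close>

unbundle bit_operations_syntax

definition shift :: "nat \<Rightarrow> nat set \<Rightarrow> nat set" where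
  "shift s x = {i. i XOR s \<in> x}"

definition ovl :: "nat \<Rightarrow> nat set \<Rightarrow> nat set \<Rightarrow> real" where
  "ovl N x y = (\<Sum>i<N. sg x i * sg y i) / real N"

text \<open>Squaring makes overlaps nonnegative, so that powers are monotone, and keeps both
  structures needed: a Gram kernel, and a distance \<open>1 - rho\<close> that obeys the triangle
  inequality.\<close>

definition rho :: "nat \<Rightarrow> nat set \<Rightarrow> nat set \<Rightarrow> real" where
  "rho N x y = (ovl N x y)\<^sup>2"

text \<open>Of the exponent 32, eight are spent on summability over the shifts
  (\<open>sum_rho_shift_le\<close>); the rest suppresses all but the best shift. A fixed exponent
  costs only a constant factor on cube edges.\<close>

definition ker :: "nat \<Rightarrow> nat set \<Rightarrow> nat set \<Rightarrow> real" where
  "ker N x y = (\<Sum>s<N. rho N x (shift s y) ^ 32)"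

text \<open>In the Gram matrix of \<open>rho ^ 4\<close> on the shifts of \<open>y\<close>, this is
  the off-diagonal part of a row sum; by invariance all rows have the same sum.\<close>

definition self_ovl :: "nat \<Rightarrow> nat set \<Rightarrow> real" where
  "self_ovl N y = (\<Sum>u\<in>{..<N} - {0}. rho N y (shift u y) ^ 4)"

lemma xor_less_exp: "a < 2 ^ m \<Longrightarrow> b < 2 ^ m \<Longrightarrow> a XOR b < 2 ^ m" for a b :: nat
  by (metis take_bit_nat_eq_self_iff take_bit_xor)

lemma xor_cancel [simp]: "(a XOR b) XOR b = a" "b XOR (b XOR a) = a" for a b :: nat
  by (simp_all add: xor.assoc) (simp add: xor.assoc[symmetric])

lemma bij_betw_xor:
  assumes "s < 2 ^ m"
  shows "bij_betw (\<lambda>i. i XOR s) {..<2 ^ m} {..<(2 :: nat) ^ m}"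
  by (rule bij_betw_byWitness[where f' = "\<lambda>i. i XOR s"]) (use assms xor_less_exp in auto)

lemma sum_xor:
  fixes f :: "nat \<Rightarrow> real"
  assumes "s < 2 ^ m"
  shows "(\<Sum>i<2 ^ m. f (i XOR s)) = (\<Sum>i<2 ^ m. f i)"
  by (rule sum.reindex_bij_betw[OF bij_betw_xor[OF assms]])

lemma sg_shift: "sg (shift s x) i = sg x (i XOR s)"
  by (simp add: sg_def shift_def)

lemma shift_0 [simp]: "shift 0 x = x"
  by (simp add: shift_def)

lemma shift_shift: "shift s (shift t x) = shift (s XOR t) x"
  by (simp add: shift_def xor.assoc)

lemma shift_same [simp]: "shift s (shift s x) = x"
  by (simp add: shift_shift)

lemma shift_subset:
  assumes "s < 2 ^ m" "x \<subseteq> {..<2 ^ m}"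
  shows "shift s x \<subseteq> {..<2 ^ m}"
proof
  fix i assume "i \<in> shift s x"
  then have "i XOR s < 2 ^ m" using assms by (auto simp: shift_def)
  from xor_less_exp[OF this assms(1)] show "i \<in> {..<2 ^ m}" by simp
qed

lemma shift_flip: "shift s (flip i x) = flip (i XOR s) (shift s x)"
proof (rule set_eqI)
  fix j
  have "j XOR s = i \<longleftrightarrow> j = i XOR s" by auto
  then show "j \<in> shift s (flip i x) \<longleftrightarrow> j \<in> flip (i XOR s) (shift s x)"
    by (simp add: shift_def flip_iff)
qed

lemma ovl_shift:
  assumes "s < 2 ^ m"
  shows "ovl (2 ^ m) (shift s x) (shift s y) = ovl (2 ^ m) x y"
  unfolding ovl_def sg_shift using sum_xor[OF assms, of "\<lambda>i. sg x i * sg y i"] by simp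

lemma ovl_commute: "ovl N x y = ovl N y x"
  by (simp add: ovl_def mult.commute)

lemma ovl_self: "0 < N \<Longrightarrow> ovl N x x = 1"
  by (simp add: ovl_def)

lemma abs_ovl_le: "\<bar>ovl N x y\<bar> \<le> 1"
proof (cases "N = 0")
  case False
  have "\<bar>\<Sum>i<N. sg x i * sg y i\<bar> \<le> (\<Sum>i<N. \<bar>sg x i * sg y i\<bar>)"
    by (rule sum_abs)
  then show ?thesis using False by (simp add: ovl_def abs_mult field_simps)
qed (simp add: ovl_def)

lemma rho_commute: "rho N x y = rho N y x"
  by (simp add: rho_def ovl_commute)

lemma rho_nonneg [simp]: "0 \<le> rho N x y"
  by (simp add: rho_def)

lemma rho_le_1 [simp]: "rho N x y \<le> 1"
  using abs_ovl_le[of N x y] by (simp add: rho_def abs_square_le_1)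

lemma rho_self: "0 < N \<Longrightarrow> rho N x x = 1"
  by (simp add: rho_def ovl_self)

lemma rho_shift:
  assumes "s < 2 ^ m"
  shows "rho (2 ^ m) (shift s x) (shift s y) = rho (2 ^ m) x y"
  by (simp add: rho_def ovl_shift[OF assms])

lemma rho_shift_left:
  assumes "s < 2 ^ m"
  shows "rho (2 ^ m) (shift s x) y = rho (2 ^ m) x (shift s y)"
  using rho_shift[OF assms, of x "shift s y"] by simp

text \<open>\<open>1 - rho\<close> is a rescaled Hamming distance between the sign vectors \<open>x \<otimes> x\<close> and \<open>y \<otimes> y\<close>.\<close>
lemma rho_diff_le:
  assumes "0 < N"
  shows "\<bar>rho N x z - rho N x y\<bar> \<le> 1 - rho N y z"
proof -
  define T where "T u i j = sg u i * sg u j" for u and i j :: nat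
  have rho: "rho N u v * (real N)\<^sup>2 = (\<Sum>i<N. \<Sum>j<N. T u i j * T v i j)" for u v
    using assms by (simp add: rho_def ovl_def power_divide power2_eq_square sum_product T_def ac_simps)
  have T: "T u i j = 1 \<or> T u i j = -1" for u i j by (simp add: T_def sg_def)
  have "\<bar>rho N x z - rho N x y\<bar> * (real N)\<^sup>2 = \<bar>(rho N x z - rho N x y) * (real N)\<^sup>2\<bar>"
    by (simp add: abs_mult)
  also have "\<dots> = \<bar>\<Sum>i<N. \<Sum>j<N. T x i j * (T z i j - T y i j)\<bar>"
    by (simp add: left_diff_distrib rho right_diff_distrib sum_subtractf)
  also have "\<dots> \<le> (\<Sum>i<N. \<bar>\<Sum>j<N. T x i j * (T z i j - T y i j)\<bar>)"
    by (rule sum_abs)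
  also have "\<dots> \<le> (\<Sum>i<N. \<Sum>j<N. \<bar>T x i j * (T z i j - T y i j)\<bar>)"
    by (intro sum_mono sum_abs)
  also have "\<dots> = (\<Sum>i<N. \<Sum>j<N. 1 - T y i j * T z i j)"
  proof (intro sum.cong refl)
    fix i j
    show "\<bar>T x i j * (T z i j - T y i j)\<bar> = 1 - T y i j * T z i j"
      using T[of x i j] T[of y i j] T[of z i j] by (elim disjE) simp_all
  qed
  also have "\<dots> = (1 - rho N y z) * (real N)\<^sup>2"
    unfolding left_diff_distrib rho by (simp add: sum_subtractf power2_eq_square)
  finally show ?thesis using assms by (simp add: mult_le_cancel_right)
qed

lemma ker_shift_right:
  assumes "t < 2 ^ m"
  shows "ker (2 ^ m) x (shift t y) = ker (2 ^ m) x y"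
  unfolding ker_def shift_shift by (rule sum_xor[OF assms])

lemma ker_commute: "ker (2 ^ m) x y = ker (2 ^ m) y x"
  unfolding ker_def
proof (rule sum.cong[OF refl])
  fix s :: nat assume "s \<in> {..<2 ^ m}"
  then show "rho (2 ^ m) x (shift s y) ^ 32 = rho (2 ^ m) y (shift s x) ^ 32"
    using rho_shift_left[of s m x y] by (metis lessThan_iff rho_commute)
qed

lemma ker_shift_left:
  assumes "t < 2 ^ m"
  shows "ker (2 ^ m) (shift t x) y = ker (2 ^ m) x y"
  using ker_shift_right[OF assms] ker_commute by metis

lemma ker_nonneg [simp]: "0 \<le> ker N x y"
  unfolding ker_def by (intro sum_nonneg) simp

section \<open>Kernels with a finite-dimensional Gram representation\<close>

definition gram :: "('a \<Rightarrow> 'a \<Rightarrow> real) \<Rightarrow> bool" where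
  "gram K \<longleftrightarrow> (\<exists>(d :: nat) v. \<forall>x y. K x y = (\<Sum>i<d. v x i * v y i))"

lemma gramI: "(\<And>x y. K x y = (\<Sum>i<d. v x i * v y i)) \<Longrightarrow> gram K" for d :: nat
  unfolding gram_def by blast

lemma gram_one: "gram (\<lambda>x y. 1)"
  by (rule gramI[where d = 1 and v = "\<lambda>_ _. 1"]) simp

lemma gram_mult:
  assumes "gram K" "gram L"
  shows "gram (\<lambda>x y. K x y * L x y)"
proof -
  obtain d e :: nat and v w where K: "\<forall>x y. K x y = (\<Sum>i<d. v x i * v y i)"
    and L: "\<forall>x y. L x y = (\<Sum>i<e. w x i * w y i)"
    using assms unfolding gram_def by (elim exE)
  show ?thesis
    by (rule gramI[where d = "d * e" and v = "\<lambda>x i. v x (i div e) * w x (i mod e)"])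
      (simp add: K L sum_mult_product sum_product ac_simps)
qed

lemma gram_power: "gram K \<Longrightarrow> gram (\<lambda>x y. K x y ^ n)"
  by (induction n) (simp_all add: gram_one gram_mult)

lemma gram_cmult:
  assumes "gram K" "0 \<le> c"
  shows "gram (\<lambda>x y. c * K x y)"
proof -
  obtain d :: nat and v where K: "\<forall>x y. K x y = (\<Sum>i<d. v x i * v y i)"
    using assms unfolding gram_def by (elim exE conjE)
  have c: "sqrt c * a * (sqrt c * b) = c * (a * b)" for a b
  proof -
    have "sqrt c * a * (sqrt c * b) = (sqrt c * sqrt c) * (a * b)" by (simp only: ac_simps)
    then show ?thesis using assms by simp
  qed
  show ?thesis
    by (rule gramI[where d = d and v = "\<lambda>x i. sqrt c * v x i"])
      (simp add: K sum_distrib_left c)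
qed

text \<open>\<open>ker\<close> shifts only one argument and is not visibly a Gram kernel. Shifting
  both arguments gives the inner products of the summed vectors, and by invariance this is a
  multiple of \<open>ker\<close>.\<close>

lemma gram_average:
  assumes "gram K"
  shows "gram (\<lambda>x y. \<Sum>s\<in>A. \<Sum>t\<in>A. K (f s x) (f t y))"
proof -
  obtain d :: nat and v where K: "\<forall>x y. K x y = (\<Sum>i<d. v x i * v y i)"
    using assms unfolding gram_def by (elim exE conjE)
  show ?thesis
  proof (rule gramI[where d = d and v = "\<lambda>x i. \<Sum>s\<in>A. v (f s x) i"])
    fix x y
    have "(\<Sum>s\<in>A. \<Sum>t\<in>A. K (f s x) (f t y)) = (\<Sum>s\<in>A. \<Sum>i<d. \<Sum>t\<in>A. v (f s x) i * v (f t y) i)"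
      unfolding K[rule_format] by (rule sum.cong[OF refl], rule sum.swap)
    also have "\<dots> = (\<Sum>i<d. \<Sum>s\<in>A. \<Sum>t\<in>A. v (f s x) i * v (f t y) i)"
      by (rule sum.swap)
    finally show "(\<Sum>s\<in>A. \<Sum>t\<in>A. K (f s x) (f t y)) = (\<Sum>i<d. (\<Sum>s\<in>A. v (f s x) i) * (\<Sum>s\<in>A. v (f s y) i))"
      by (simp add: sum_product)
  qed
qed

lemma gram_ovl: "gram (ovl N)"
proof (cases "N = 0")
  case True
  then show ?thesis by (intro gramI[where d = 0]) (simp add: ovl_def)
next
  case False
  then show ?thesis
    by (intro gramI[where d = N and v = "\<lambda>x i. sg x i / sqrt N"]) (simp add: ovl_def sum_divide_distrib)
qed

lemma gram_rho: "gram (rho N)"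
  using gram_power[OF gram_ovl, of N 2] by (simp add: rho_def[abs_def])

lemma gram_bessel:
  assumes "gram K"
  shows "(\<Sum>s\<in>A. a s * K x (Y s))\<^sup>2 \<le> K x x * (\<Sum>s\<in>A. \<Sum>t\<in>A. a s * a t * K (Y s) (Y t))"
proof -
  obtain d :: nat and v where K: "\<forall>x y. K x y = (\<Sum>i<d. v x i * v y i)"
    using assms unfolding gram_def by (elim exE conjE)
  define w where "w i = (\<Sum>s\<in>A. a s * v (Y s) i)" for i
  have "(\<Sum>s\<in>A. a s * K x (Y s)) = (\<Sum>s\<in>A. \<Sum>i<d. v x i * (a s * v (Y s) i))"
    by (simp add: K sum_distrib_left mult.left_commute)
  also have "\<dots> = (\<Sum>i<d. v x i * w i)"
    unfolding w_def sum_distrib_left by (rule sum.swap)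
  finally have 1: "(\<Sum>s\<in>A. a s * K x (Y s)) = (\<Sum>i<d. v x i * w i)" .
  have "(\<Sum>s\<in>A. \<Sum>t\<in>A. a s * a t * K (Y s) (Y t))
      = (\<Sum>s\<in>A. \<Sum>i<d. \<Sum>t\<in>A. (a s * v (Y s) i) * (a t * v (Y t) i))"
  proof (rule sum.cong[OF refl])
    fix s
    have "(\<Sum>t\<in>A. a s * a t * K (Y s) (Y t)) = (\<Sum>t\<in>A. \<Sum>i<d. (a s * v (Y s) i) * (a t * v (Y t) i))"
      unfolding K[rule_format] sum_distrib_left by (simp only: ac_simps)
    also have "\<dots> = (\<Sum>i<d. \<Sum>t\<in>A. (a s * v (Y s) i) * (a t * v (Y t) i))"
      by (rule sum.swap)
    finally show "(\<Sum>t\<in>A. a s * a t * K (Y s) (Y t)) = (\<Sum>i<d. \<Sum>t\<in>A. (a s * v (Y s) i) * (a t * v (Y t) i))" .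
  qed
  also have "\<dots> = (\<Sum>i<d. (w i)\<^sup>2)"
    unfolding w_def power2_eq_square sum_product by (rule sum.swap)
  finally have 2: "(\<Sum>s\<in>A. \<Sum>t\<in>A. a s * a t * K (Y s) (Y t)) = (\<Sum>i<d. (w i)\<^sup>2)" .
  have "(\<Sum>i<d. v x i * w i)\<^sup>2 \<le> (\<Sum>i<d. (v x i)\<^sup>2) * (\<Sum>i<d. (w i)\<^sup>2)"
    by (rule Cauchy_Schwarz_ineq_sum)
  then show ?thesis unfolding 1 2 by (simp add: K power2_eq_square)
qed

text \<open>The vectors of the kernel \<open>rho ^ 4\<close> at the shifts of \<open>y\<close> are nearly orthonormal.\<close>
lemma sum_rho_shift_le: "(\<Sum>s<2 ^ m. rho (2 ^ m) x (shift s y) ^ 8) \<le> 1 + self_ovl (2 ^ m) y"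
proof -
  define N :: nat where "N = 2 ^ m"
  define a where "a s = rho N x (shift s y) ^ 4" for s
  define g where "g u = rho N y (shift u y) ^ 4" for u
  define Q where "Q = (\<Sum>s<N. (a s)\<^sup>2)"
  have N: "0 < N" by (simp add: N_def)
  have a0: "0 \<le> a s" and g0: "0 \<le> g s" for s by (simp_all add: a_def g_def)
  have Q0: "0 \<le> Q" by (simp add: Q_def sum_nonneg)
  have sx: "(\<Sum>s<N. f (s XOR t)) = (\<Sum>s<N. f s)" if "t < N" for f :: "nat \<Rightarrow> real" and t
    using sum_xor[of t m f] that by (simp add: N_def)
  have G: "rho N (shift s y) (shift t y) ^ 4 = g (t XOR s)" if "s < N" for s t
    using rho_shift_left[of s m y "shift t y"] that
    by (simp add: g_def N_def shift_shift xor.commute)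
  \<comment> \<open>The coefficients are the inner products themselves, so the left side is Q^2 and
    one factor Q cancels at the end.\<close>
  have "(\<Sum>s<N. a s * rho N x (shift s y) ^ 4)\<^sup>2
      \<le> rho N x x ^ 4 * (\<Sum>s<N. \<Sum>t<N. a s * a t * rho N (shift s y) (shift t y) ^ 4)"
    by (rule gram_bessel[OF gram_power[OF gram_rho]])
  then have "Q\<^sup>2 \<le> (\<Sum>s<N. \<Sum>t<N. a s * a t * rho N (shift s y) (shift t y) ^ 4)"
    using N by (simp add: Q_def a_def power2_eq_square rho_self)
  also have "\<dots> = (\<Sum>s<N. \<Sum>t<N. a s * a t * g (t XOR s))"
    by (simp add: G)
  \<comment> \<open>Schur test: splitting the products into squares leaves only the row sums of the
    Gram matrix, which are all equal.\<close>
  also have "\<dots> \<le> (\<Sum>s<N. \<Sum>t<N. ((a s)\<^sup>2 / 2 + (a t)\<^sup>2 / 2) * g (t XOR s))"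
  proof (intro sum_mono mult_right_mono g0)
    fix s t
    show "a s * a t \<le> (a s)\<^sup>2 / 2 + (a t)\<^sup>2 / 2"
      using zero_le_power2[of "a s - a t"] by (simp add: power2_eq_square algebra_simps)
  qed
  also have "\<dots> = (\<Sum>s<N. \<Sum>t<N. (a s)\<^sup>2 / 2 * g (t XOR s)) + (\<Sum>t<N. \<Sum>s<N. (a t)\<^sup>2 / 2 * g (s XOR t))"
    unfolding distrib_right sum.distrib
    by (subst (2) sum.swap) (simp add: xor.commute)
  also have "(\<Sum>s<N. \<Sum>t<N. (a s)\<^sup>2 / 2 * g (t XOR s)) = (\<Sum>s<N. (a s)\<^sup>2 / 2 * (\<Sum>t<N. g t))"
    by (intro sum.cong refl) (simp only: sum_distrib_left[symmetric] sx lessThan_iff)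
  also have "\<dots> + \<dots> = Q * (\<Sum>t<N. g t)"
    by (simp add: Q_def sum_distrib_right[symmetric] sum_divide_distrib[symmetric])
  finally have "Q * Q \<le> Q * (\<Sum>t<N. g t)" by (simp add: power2_eq_square)
  moreover have "0 \<le> (\<Sum>t<N. g t)" using g0 by (intro sum_nonneg)
  ultimately have "Q \<le> (\<Sum>t<N. g t)"
    using Q0 by (cases "Q = 0") (auto simp: mult_le_cancel_left)
  also have "\<dots> = g 0 + (\<Sum>t\<in>{..<N} - {0}. g t)"
    using N by (intro sum.remove) auto
  also have "\<dots> = 1 + self_ovl N y"
    using N by (simp add: g_def self_ovl_def rho_self)
  finally show ?thesis by (simp add: Q_def a_def N_def power_mult[symmetric])
qed

text \<open>As \<open>ker\<close> ignores shifts of either argument, \<open>x\<close> and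
  \<open>z\<close> may be moved so that both overlap best with \<open>y\<close> at the zero shift.
  If the best overlap with \<open>x\<close> is close to 1, a second sizeable one would force a large
  self-overlap of \<open>y\<close>, which is excluded; likewise for \<open>z\<close>.\<close>

lemma ker_triangle:
  assumes y: "self_ovl (2 ^ m) y \<le> 1 / 2 ^ m" and m: "12 \<le> m"
  shows "ker (2 ^ m) x y + ker (2 ^ m) y z \<le> 1 + ker (2 ^ m) x z + 2 / 2 ^ m"
proof -
  define N :: nat where "N = 2 ^ m"
  define \<eta> :: real where "\<eta> = 1 / 2 ^ m"
  have N: "0 < N" by (simp add: N_def)
  have \<eta>: "0 \<le> \<eta>" "\<eta> \<le> 1 / 4096"
    using power_increasing[OF m, of "2::real"] by (simp_all add: \<eta>_def field_simps)
  have aligned: "ker N x y + ker N y z \<le> 1 + ker N x z + 2 * \<eta>"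
    if xy: "\<And>s. s < N \<Longrightarrow> rho N x (shift s y) \<le> rho N x y"
    and yz: "\<And>s. s < N \<Longrightarrow> rho N y (shift s z) \<le> rho N y z"
    and le: "rho N x y \<le> rho N y z" for x z
  proof -
    define A where "A s = rho N x (shift s y)" for s
    define B where "B s = rho N y (shift s z)" for s
    define C where "C s = rho N x (shift s z)" for s
    define \<theta> where "\<theta> s = rho N y (shift s y)" for s
    have Bz: "B s = rho N z (shift s y)" if "s < N" for s
      using rho_shift_left[of s m y z] that by (simp add: B_def N_def rho_commute[of _ z])
    have "(\<Sum>s<N. A s ^ 32) + (\<Sum>s<N. B s ^ 32) \<le> 1 + (\<Sum>s<N. C s ^ 32) + 2 * \<eta>"
    proof (rule overlap_triangle_aux[of "{..<N}" 0 A B C \<eta> \<theta>])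
      show "(\<Sum>s<N. A s ^ 8) \<le> 1 + \<eta>"
        using sum_rho_shift_le[of m x y] y by (simp add: A_def N_def \<eta>_def)
      have "(\<Sum>s<N. B s ^ 8) = (\<Sum>s<N. rho N z (shift s y) ^ 8)"
        by (intro sum.cong refl) (simp add: Bz)
      then show "(\<Sum>s<N. B s ^ 8) \<le> 1 + \<eta>"
        using sum_rho_shift_le[of m z y] y by (simp add: N_def \<eta>_def)
      show "0 \<le> A s \<and> A s \<le> A 0" if "s \<in> {..<N}" for s
        using that xy by (simp add: A_def)
      show "0 \<le> B s \<and> B s \<le> B 0" if "s \<in> {..<N}" for s
        using that yz by (simp add: B_def)
      show "0 \<le> C s \<and> \<bar>A s - C s\<bar> \<le> 1 - B 0" if "s \<in> {..<N}" for s
        using rho_diff_le[OF N, of x "shift s y" "shift s z"] rho_shift[of s m y z] that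
        by (simp add: A_def B_def C_def N_def rho_commute)
      show "0 \<le> \<theta> s \<and> \<theta> s ^ 4 \<le> \<eta> \<and> A s \<le> \<theta> s + (1 - A 0) \<and> B s \<le> \<theta> s + (1 - B 0)"
        if "s \<in> {..<N} - {0}" for s
      proof (intro conjI)
        have "\<theta> s ^ 4 \<le> self_ovl N y"
          unfolding self_ovl_def \<theta>_def using that
          by (intro member_le_sum) auto
        then show "\<theta> s ^ 4 \<le> \<eta>" using y by (simp add: N_def \<eta>_def)
        show "A s \<le> \<theta> s + (1 - A 0)"
          using rho_diff_le[OF N, of "shift s y" x y]
          by (simp add: A_def \<theta>_def rho_commute)
        show "B s \<le> \<theta> s + (1 - B 0)"
          using rho_diff_le[OF N, of "shift s y" z y] Bz[of s] Bz[of 0] that N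
          by (simp add: \<theta>_def rho_commute)
      qed (simp add: \<theta>_def)
    qed (use N \<eta> le in \<open>auto simp: A_def B_def\<close>)
    then show ?thesis by (simp add: ker_def A_def B_def C_def)
  qed
  have max: "\<exists>t<N. \<forall>s<N. f s \<le> f t" for f :: "nat \<Rightarrow> real"
  proof -
    have "Max (f ` {..<N}) \<in> f ` {..<N}" using N by (intro Max_in) auto
    then obtain t where "t < N" "Max (f ` {..<N}) = f t" by auto
    then show ?thesis by (intro exI[of _ t]) (metis Max_ge finite_imageI finite_lessThan imageI lessThan_iff)
  qed
  obtain t where t: "t < N" "\<And>s. s < N \<Longrightarrow> rho N x (shift s y) \<le> rho N x (shift t y)"
    using max[of "\<lambda>s. rho N x (shift s y)"] by blast
  obtain r where r: "r < N" "\<And>s. s < N \<Longrightarrow> rho N y (shift s z) \<le> rho N y (shift r z)"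
    using max[of "\<lambda>s. rho N y (shift s z)"] by blast
  define x' where "x' = shift t x"
  define z' where "z' = shift r z"
  have xor: "a XOR b < N" if "a < N" "b < N" for a b
    using xor_less_exp that by (simp add: N_def)
  have xy: "rho N x' (shift s y) \<le> rho N x' y" if "s < N" for s
  proof -
    have "rho N x' (shift s y) = rho N x (shift (t XOR s) y)" "rho N x' y = rho N x (shift t y)"
      using rho_shift_left[of t m x] t(1) by (simp_all add: x'_def N_def shift_shift)
    then show ?thesis using t(2)[OF xor[OF t(1) that]] by simp
  qed
  have yz: "rho N y (shift s z') \<le> rho N y z'" if "s < N" for s
    using r(2)[OF xor[OF that r(1)]] by (simp add: z'_def shift_shift)
  have xy': "rho N y (shift s x') \<le> rho N y x'" if "s < N" for s
    using xy[OF that] rho_shift_left[of s m y x'] that by (simp add: rho_commute N_def)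
  have yz': "rho N z' (shift s y) \<le> rho N z' y" if "s < N" for s
    using yz[OF that] rho_shift_left[of s m z' y] that by (simp add: rho_commute N_def)
  have "ker N x' y + ker N y z' \<le> 1 + ker N x' z' + 2 * \<eta>"
  proof (cases "rho N x' y \<le> rho N y z'")
    case True
    then show ?thesis using aligned xy yz by blast
  next
    case False
    \<comment> \<open>Exchanging the outer points keeps the middle one and restores the order that
      \<open>overlap_triangle_aux\<close> assumes.\<close>
    then have "ker N z' y + ker N y x' \<le> 1 + ker N z' x' + 2 * \<eta>"
      using aligned[of z' x'] xy' yz' by (simp add: rho_commute)
    then show ?thesis by (simp add: ker_commute[of m z' y] ker_commute[of m y x'] ker_commute[of m z' x'] N_def)
  qed
  then show ?thesis
    using t(1) r(1) by (simp add: x'_def z'_def N_def \<eta>_def ker_shift_left ker_shift_right)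
qed

section \<open>Nearly orthogonal orbits and the SDP vectors\<close>

lemma walsh_singleton [simp]: "walsh {i} x = sg x i"
  by (simp add: walsh_def)

lemma walsh_pair: "i \<noteq> j \<Longrightarrow> walsh {i, j} x = sg x i * sg x j"
  by (simp add: walsh_def)

lemma avg_rho_le:
  assumes "0 < N"
  shows "avg N (\<lambda>x. rho N x y ^ 2) \<le> 9 / (real N)\<^sup>2"
proof -
  define h where "h x = (\<Sum>i<N. sg y i * walsh {i} x)" for x
  have ld: "lowdeg N 1 h"
    unfolding h_def by (rule lowdeg_sum, rule lowdeg.walsh) auto
  have "avg N (\<lambda>x. (h x)\<^sup>2) = avg N (\<lambda>x. \<Sum>i<N. \<Sum>j<N. (sg y i * sg y j) * (walsh {i} x * walsh {j} x))"
    by (simp add: h_def power2_eq_square sum_product ac_simps)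
  also have "\<dots> = (\<Sum>i<N. \<Sum>j<N. (sg y i * sg y j) * (if {i} = {j} then 1 else 0))"
    unfolding avg_sum avg_cmult
    by (intro sum.cong refl arg_cong2[where f = "(*)"] avg_walsh_mult) auto
  also have "\<dots> = real N"
    by (simp add: if_distrib cong: if_cong)
  finally have h2: "avg N (\<lambda>x. (h x)\<^sup>2) = real N" .
  have "rho N x y ^ 2 = (1 / real N ^ 4) * h x ^ 4" for x
    by (simp add: rho_def ovl_def h_def power_divide mult.commute)
  then have "avg N (\<lambda>x. rho N x y ^ 2) = (1 / real N ^ 4) * avg N (\<lambda>x. h x ^ 4)"
    by (simp only: avg_cmult)
  also have "\<dots> \<le> (1 / real N ^ 4) * (9 ^ 1 * (avg N (\<lambda>x. (h x)\<^sup>2))\<^sup>2)"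
    by (intro mult_left_mono bonami[OF ld]) simp
  also have "\<dots> = 9 / (real N)\<^sup>2"
    unfolding h2 using assms by (simp add: power2_eq_square power4_eq_xxxx)
  finally show ?thesis .
qed

text \<open>Typical pairs are nearly orthogonal, which will spread the SDP vectors enough for the
  demand constraint. Bounding \<open>rho ^ 32\<close> by \<open>rho ^ 2\<close> leaves N shifts at
  O(1/N^2) each.\<close>

lemma avg_ker_le:
  assumes "0 < N"
  shows "avg N (\<lambda>x. ker N x y) \<le> 9 / real N"
proof -
  have "avg N (\<lambda>x. ker N x y) \<le> avg N (\<lambda>x. \<Sum>s<N. rho N x (shift s y) ^ 2)"
    unfolding ker_def by (intro avg_mono sum_mono power_decreasing) auto
  also have "\<dots> \<le> (\<Sum>s<N. 9 / (real N)\<^sup>2)"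
    unfolding avg_sum using avg_rho_le[OF assms] by (intro sum_mono)
  also have "\<dots> = 9 / real N"
    by (simp add: power2_eq_square)
  finally show ?thesis .
qed

text \<open>The unnormalised self-overlap is a quadratic form in the signs in which each pair {i, i
  XOR u} occurs twice, so its second moment is at most 2N. Bonami is applied to the form and then to
  its square, of degree 4, which gives the eighth moment.\<close>

lemma avg_rho_shift_le:
  assumes "u < 2 ^ m" "u \<noteq> 0"
  defines "N \<equiv> 2 ^ m"
  shows "avg N (\<lambda>y. rho N y (shift u y) ^ 4) \<le> 10 ^ 9 / real N ^ 4"
proof -
  have N: "0 < N" by (simp add: N_def)
  define p where "p i = {i, i XOR u}" for i
  have ne: "i \<noteq> i XOR u" for i
  proof
    assume "i = i XOR u"
    then have "i XOR i = u" by (metis xor_cancel(2))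
    then show False using assms by simp
  qed
  have lt: "i XOR u < N" if "i < N" for i
    using xor_less_exp that assms by (simp add: N_def)
  define g where "g y = (\<Sum>i<N. 1 * walsh (p i) y)" for y
  have ld: "lowdeg N 2 g"
    unfolding g_def
    by (rule lowdeg_sum, rule lowdeg.walsh) (use lt ne in \<open>auto simp: p_def\<close>)
  have "avg N (\<lambda>y. (g y)\<^sup>2) = avg N (\<lambda>y. \<Sum>i<N. \<Sum>j<N. walsh (p i) y * walsh (p j) y)"
    by (simp add: g_def power2_eq_square sum_product)
  also have "\<dots> = (\<Sum>i<N. \<Sum>j<N. if p i = p j then 1 else 0)"
    unfolding avg_sum
    by (intro sum.cong refl avg_walsh_mult) (use lt in \<open>auto simp: p_def\<close>)
  also have "\<dots> \<le> (\<Sum>i<N. 2)"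
  proof (rule sum_mono)
    fix i assume "i \<in> {..<N}"
    have "(\<Sum>j<N. if p i = p j then 1 else 0 :: real) = real (card {j \<in> {..<N}. p i = p j})"
      by (simp add: sum.If_cases Int_def)
    also have "{j \<in> {..<N}. p i = p j} \<subseteq> {i, i XOR u}"
      by (auto simp: p_def doubleton_eq_iff)
    then have "card {j \<in> {..<N}. p i = p j} \<le> card {i, i XOR u}"
      by (intro card_mono) auto
    then have "real (card {j \<in> {..<N}. p i = p j}) \<le> 2" using ne by simp
    finally show "(\<Sum>j<N. if p i = p j then 1 else 0 :: real) \<le> 2" .
  qed
  finally have g2: "avg N (\<lambda>y. (g y)\<^sup>2) \<le> 2 * real N" by simp
  have g20: "0 \<le> avg N (\<lambda>y. (g y)\<^sup>2)" by (intro avg_nonneg) simp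
  have "avg N (\<lambda>y. g y ^ 4) \<le> 9 ^ 2 * (avg N (\<lambda>y. (g y)\<^sup>2))\<^sup>2"
    by (rule bonami[OF ld])
  also have "\<dots> \<le> 9 ^ 2 * (2 * real N)\<^sup>2"
    using g2 g20 by (intro mult_left_mono power_mono) auto
  finally have g4: "avg N (\<lambda>y. g y ^ 4) \<le> 324 * (real N)\<^sup>2" by (simp add: power_mult_distrib)
  have g40: "0 \<le> avg N (\<lambda>y. g y ^ 4)" by (intro avg_nonneg) simp
  have "avg N (\<lambda>y. (g y * g y) ^ 4) \<le> 9 ^ (2 + 2) * (avg N (\<lambda>y. (g y * g y)\<^sup>2))\<^sup>2"
    by (rule bonami[OF lowdeg_mult[OF ld ld]])
  also have "(\<lambda>y. (g y * g y)\<^sup>2) = (\<lambda>y. g y ^ 4)"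
    by (simp add: fun_eq_iff power2_eq_square power4_eq_xxxx)
  also have "9 ^ (2 + 2) * (avg N (\<lambda>y. g y ^ 4))\<^sup>2 \<le> 9 ^ (2 + 2) * (324 * (real N)\<^sup>2)\<^sup>2"
    using g4 g40 by (intro mult_left_mono power_mono) auto
  also have "\<dots> \<le> 10 ^ 9 * real N ^ 4"
    by (simp add: power_mult_distrib)
  finally have g8: "avg N (\<lambda>y. (g y * g y) ^ 4) \<le> 10 ^ 9 * real N ^ 4" .
  have "rho N y (shift u y) ^ 4 = (1 / real N ^ 8) * (g y * g y) ^ 4" for y
    unfolding rho_def ovl_def sg_shift g_def p_def
    by (simp add: walsh_pair[OF ne] power_divide power2_eq_square[symmetric])
  then have "avg N (\<lambda>y. rho N y (shift u y) ^ 4) = (1 / real N ^ 8) * avg N (\<lambda>y. (g y * g y) ^ 4)"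
    by (simp only: avg_cmult)
  also have "\<dots> \<le> (1 / real N ^ 8) * (10 ^ 9 * real N ^ 4)"
    by (intro mult_left_mono g8) simp
  also have "\<dots> = 10 ^ 9 / real N ^ 4"
    using N by (simp add: field_simps power_add[symmetric])
  finally show ?thesis .
qed

definition good :: "nat \<Rightarrow> nat set set" where
  "good N = {y. y \<subseteq> {..<N} \<and> self_ovl N y \<le> 1 / real N}"

text \<open>Markov's inequality at the threshold 1/N. At N cube edges per point, bad points touch
  only O(2^N / N) edges, negligible against a boundary of order m 2^N.\<close>

lemma card_bad_le:
  fixes m :: nat
  defines "N \<equiv> 2 ^ m"
  shows "real (card (Pow {..<N} - good N)) \<le> 10 ^ 9 / (real N)\<^sup>2 * 2 ^ N"
proof -
  have N: "0 < N" by (simp add: N_def)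
  have "avg N (self_ovl N) \<le> (\<Sum>u\<in>{..<N} - {0}. 10 ^ 9 / real N ^ 4)"
    unfolding self_ovl_def avg_sum
    by (intro sum_mono) (use avg_rho_shift_le[of _ m] in \<open>auto simp: N_def\<close>)
  also have "\<dots> \<le> real N * (10 ^ 9 / real N ^ 4)"
    using N by (simp add: card_Diff_subset mult_right_mono divide_right_mono)
  also have "\<dots> = 10 ^ 9 / real N ^ 3"
    using N by (simp add: power4_eq_xxxx power3_eq_cube)
  finally have 1: "avg N (self_ovl N) \<le> 10 ^ 9 / real N ^ 3" .
  have "(\<Sum>y\<in>Pow {..<N} - good N. 1 / real N) \<le> (\<Sum>y\<in>Pow {..<N} - good N. self_ovl N y)"
    by (intro sum_mono) (auto simp: good_def)
  also have "\<dots> \<le> (\<Sum>y\<in>Pow {..<N}. self_ovl N y)"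
    by (rule sum_mono2) (auto simp: self_ovl_def sum_nonneg)
  also have "\<dots> = avg N (self_ovl N) * 2 ^ N" by (simp add: avg_def)
  also have "\<dots> \<le> 10 ^ 9 / real N ^ 3 * 2 ^ N"
    using 1 by (intro mult_right_mono) auto
  finally have "real (card (Pow {..<N} - good N)) / real N \<le> 10 ^ 9 / real N ^ 3 * 2 ^ N"
    by simp
  then have "real (card (Pow {..<N} - good N)) \<le> 10 ^ 9 / real N ^ 3 * 2 ^ N * real N"
    using N by (simp add: pos_divide_le_eq)
  also have "\<dots> = 10 ^ 9 / (real N)\<^sup>2 * 2 ^ N"
    using N by (simp add: power2_eq_square power3_eq_cube)
  finally show ?thesis .
qed

lemma self_ovl_shift:
  assumes "t < 2 ^ m"
  shows "self_ovl (2 ^ m) (shift t y) = self_ovl (2 ^ m) y"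
proof -
  have "rho (2 ^ m) (shift t y) (shift u (shift t y)) = rho (2 ^ m) y (shift u y)" for u
    using rho_shift[OF assms, of y "shift u y"] by (simp add: shift_shift xor.commute)
  then show ?thesis by (simp add: self_ovl_def)
qed

lemma good_shift: "t < 2 ^ m \<Longrightarrow> y \<in> good (2 ^ m) \<Longrightarrow> shift t y \<in> good (2 ^ m)"
  by (simp add: good_def self_ovl_shift shift_subset)

text \<open>Together with the factor 1 - 2/N this keeps the kernel part of a vector within unit
  length and leaves room for the private coordinate.\<close>

lemma ker_self_le:
  assumes "y \<in> good N" "0 < N"
  shows "ker N y y \<le> 1 + 1 / real N"
proof -
  have "ker N y y = rho N y y ^ 32 + (\<Sum>u\<in>{..<N} - {0}. rho N y (shift u y) ^ 32)"
    unfolding ker_def using assms(2) by (subst sum.remove[of _ 0]) auto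
  also have "(\<Sum>u\<in>{..<N} - {0}. rho N y (shift u y) ^ 32) \<le> self_ovl N y"
    unfolding self_ovl_def by (intro sum_mono power_decreasing) auto
  finally show ?thesis using assms by (simp add: rho_self good_def)
qed

text \<open>The zero shift alone contributes enough: the overlap of neighbours is 1 - 2/N, it occurs
  to the power 64, and Bernoulli gives 128 = 2 * 64.\<close>

lemma ker_flip_ge:
  assumes "i < N" "2 \<le> N"
  shows "1 - 128 / real N \<le> ker N x (flip i x)"
proof -
  have "ovl N x (flip i x) = 1 - 2 / real N"
  proof -
    have "(\<Sum>j<N. sg x j * sg (flip i x) j) = (\<Sum>j<N. 1 - (if j = i then 2 else 0))"
      by (intro sum.cong refl) (simp add: sg_flip)
    also have "\<dots> = real N - 2" using assms by (simp add: sum_subtractf)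
    finally show ?thesis using assms by (simp add: ovl_def diff_divide_distrib)
  qed
  then have "rho N x (shift 0 (flip i x)) ^ 32 = (1 - 2 / real N) ^ 64"
    by (simp add: rho_def power_mult[symmetric])
  moreover have "1 - 128 / real N \<le> (1 - 2 / real N) ^ 64"
    using Bernoulli_inequality[of "- (2 / real N)" 64] assms by simp
  moreover have "rho N x (shift 0 (flip i x)) ^ 32 \<le> ker N x (flip i x)"
    unfolding ker_def using assms by (intro member_le_sum) auto
  ultimately show ?thesis by linarith
qed

section \<open>Orbits and the vectors of the SDP solution\<close>

definition orbit :: "nat \<Rightarrow> nat set \<Rightarrow> nat set set" where
  "orbit N x = (\<lambda>s. shift s x) ` {..<N}"

lemma orbit_shift:
  assumes "t < 2 ^ m"
  shows "orbit (2 ^ m) (shift t x) = orbit (2 ^ m) x"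
proof -
  have "orbit (2 ^ m) (shift t x) = (\<lambda>s. shift s x) ` ((\<lambda>s. s XOR t) ` {..<2 ^ m})"
    by (simp add: orbit_def shift_shift image_image)
  then show ?thesis
    using bij_betw_xor[OF assms] by (simp add: orbit_def bij_betw_def)
qed

lemma self_in_orbit: "0 < N \<Longrightarrow> x \<in> orbit N x"
  unfolding orbit_def by (rule image_eqI[of _ _ 0]) auto

lemma orbit_eqD: "orbit (2 ^ m) x = orbit (2 ^ m) y \<Longrightarrow> \<exists>t<2 ^ m. y = shift t x"
proof -
  assume "orbit (2 ^ m) x = orbit (2 ^ m) y"
  then have "y \<in> orbit (2 ^ m) x" using self_in_orbit[of "2 ^ m" y] by simp
  then show ?thesis by (auto simp: orbit_def)
qed

text \<open>The SDP solution: \<open>ker\<close>, shrunk slightly, plus a private coordinate for every orbit. The private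
  coordinates normalise the vectors and pay for the error term in \<open>ker_triangle\<close>.\<close>
definition inner_prod :: "nat \<Rightarrow> nat set \<Rightarrow> nat set \<Rightarrow> real" where
  "inner_prod N x y = (if orbit N x = orbit N y then 1 else (1 - 2 / real N) * ker N x y)"

lemma inner_prod_shift:
  assumes "t < 2 ^ m"
  shows "inner_prod (2 ^ m) (shift t x) y = inner_prod (2 ^ m) x y"
    "inner_prod (2 ^ m) x (shift t y) = inner_prod (2 ^ m) x y"
  by (simp_all add: inner_prod_def orbit_shift[OF assms] ker_shift_left[OF assms] ker_shift_right[OF assms])

text \<open>The bounds by 1 on the pairs with \<open>y\<close> settle the case that \<open>x\<close>
  and \<open>z\<close> share an orbit; they are automatic once the values are realised by unit
  vectors.\<close>

lemma inner_prod_triangle: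
  assumes y: "y \<in> good (2 ^ m)" and m: "12 \<le> m" and xz: "inner_prod (2 ^ m) x z \<le> 1"
    and "inner_prod (2 ^ m) x y \<le> 1" "inner_prod (2 ^ m) y z \<le> 1"
  shows "inner_prod (2 ^ m) x y + inner_prod (2 ^ m) y z \<le> 1 + inner_prod (2 ^ m) x z"
proof -
  define N :: nat where "N = 2 ^ m"
  have "(2::nat) ^ 1 \<le> 2 ^ m" by (rule power_increasing) (use m in auto)
  then have N: "2 \<le> N" by (simp add: N_def)
  consider "orbit N x = orbit N y" | "orbit N y = orbit N z"
    | "orbit N x = orbit N z" | "orbit N x \<noteq> orbit N y" "orbit N y \<noteq> orbit N z" "orbit N x \<noteq> orbit N z"
    by blast
  then have "inner_prod N x y + inner_prod N y z \<le> 1 + inner_prod N x z"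
  proof cases
    case 1
    then obtain t where "t < 2 ^ m" "y = shift t x" using orbit_eqD[of m x y] by (auto simp: N_def)
    then show ?thesis using 1 inner_prod_shift(1)[of t m x z] by (simp add: N_def inner_prod_def)
  next
    case 2
    then obtain t where "t < 2 ^ m" "z = shift t y" using orbit_eqD[of m y z] by (auto simp: N_def)
    then show ?thesis using 2 inner_prod_shift(2)[of t m x y] by (simp add: N_def inner_prod_def)
  next
    case 3
    then have "inner_prod N x z = 1" by (simp add: inner_prod_def)
    then show ?thesis using assms by (simp add: N_def)
  next
    case 4
    define c where "c = 1 - 2 / real N"
    have c: "0 \<le> c" using N by (simp add: c_def)
    \<comment> \<open>The shrink factor is chosen against the error 2/N of
      \<open>ker_triangle\<close>: (1 - 2/N)(1 + 2/N) < 1.\<close>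
    have "c * (ker N x y + ker N y z - ker N x z) \<le> c * (1 + 2 / real N)"
      using ker_triangle[of m y x z] y m c by (intro mult_left_mono) (auto simp: good_def N_def)
    also have "\<dots> = 1 - (2 / real N)\<^sup>2" by (simp add: c_def power2_eq_square algebra_simps)
    also have "\<dots> \<le> 1" by simp
    finally show ?thesis using 4 by (simp add: inner_prod_def c_def[symmetric] algebra_simps)
  qed
  then show ?thesis by (simp add: N_def)
qed

lemma inner_prod_vectors:
  fixes m :: nat
  assumes "1 \<le> m"
  defines "N \<equiv> 2 ^ m"
  shows "\<exists>(d :: nat) v. \<forall>x\<in>good N. \<forall>y\<in>good N. inner_prod N x y = (\<Sum>i<d. v x i * v y i)"
proof -
  have "(2::nat) ^ 1 \<le> 2 ^ m" by (rule power_increasing) (use assms in auto)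
  then have N: "2 \<le> N" by (simp add: N_def)
  define c where "c = 1 - 2 / real N"
  have c: "0 \<le> c" using N by (simp add: c_def)
  have c1: "c * (1 + 1 / real N) \<le> 1" using N by (simp add: c_def field_simps)
  have fin: "finite (good N)" by (rule finite_subset[of _ "Pow {..<N}"]) (auto simp: good_def)
  have NK: "(\<Sum>s<N. \<Sum>t<N. rho N (shift s x) (shift t y) ^ 32) = real N * ker N x y" for x y
  proof -
    have "(\<Sum>t<N. rho N (shift s x) (shift t y) ^ 32) = ker N x y" if "s < N" for s
      using ker_shift_left[of s m x y] that by (simp add: ker_def N_def)
    then show ?thesis by simp
  qed
  have "gram (\<lambda>x y. c / real N * (\<Sum>s<N. \<Sum>t<N. rho N (shift s x) (shift t y) ^ 32))"
    using c by (intro gram_cmult gram_average gram_power gram_rho) simp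
  also have "(\<lambda>x y. c / real N * (\<Sum>s<N. \<Sum>t<N. rho N (shift s x) (shift t y) ^ 32)) = (\<lambda>x y. c * ker N x y)"
    using N by (simp add: NK)
  finally obtain d :: nat and v where v: "\<forall>x y. c * ker N x y = (\<Sum>i<d. v x i * v y i)"
    unfolding gram_def by (elim exE)
  \<comment> \<open>\<open>\<phi>\<close> enumerates the orbits without repetition; coordinate d + i
    will belong to the orbit \<open>\<phi> i\<close> alone.\<close>
  obtain \<phi> and e :: nat where \<phi>: "orbit N ` good N = \<phi> ` {i. i < e}" "inj_on \<phi> {i. i < e}"
    using finite_imp_nat_seg_image_inj_on[OF finite_imageI[OF fin, of "orbit N"]] by blast
  define q where "q x = sqrt (1 - c * ker N x x)" for x
  define w where "w x i = (if i < d then v x i else if orbit N x = \<phi> (i - d) then q x else 0)" for x i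
  have "inner_prod N x y = (\<Sum>i<d + e. w x i * w y i)" if x: "x \<in> good N" and y: "y \<in> good N" for x y
  proof -
    have "(\<Sum>i<d + e. w x i * w y i) = (\<Sum>i<d. w x i * w y i) + (\<Sum>i<e. w x (d + i) * w y (d + i))"
      by (induction e) auto
    also have "(\<Sum>i<d. w x i * w y i) = c * ker N x y" by (simp add: v w_def)
    also have "(\<Sum>i<e. w x (d + i) * w y (d + i)) = (if orbit N x = orbit N y then q x * q y else 0)"
    proof -
      have "orbit N x \<in> \<phi> ` {i. i < e}" using \<phi>(1) x by blast
      then obtain k where k: "k < e" "orbit N x = \<phi> k" by blast
      have "(\<Sum>i<e. w x (d + i) * w y (d + i)) = (\<Sum>i<e. if i = k then w x (d + i) * w y (d + i) else 0)"
        using k inj_onD[OF \<phi>(2)] by (intro sum.cong refl) (auto simp: w_def)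
      also have "\<dots> = w x (d + k) * w y (d + k)" using k by simp
      finally show ?thesis using k by (auto simp: w_def)
    qed
    finally have s: "(\<Sum>i<d + e. w x i * w y i) = c * ker N x y + (if orbit N x = orbit N y then q x * q y else 0)" .
    show ?thesis
    proof (cases "orbit N x = orbit N y")
      case True
      then obtain t where t: "t < 2 ^ m" "y = shift t x" using orbit_eqD[of m x y] by (auto simp: N_def)
      then have K: "ker N x y = ker N x x" "ker N y y = ker N x x"
        by (simp_all add: N_def ker_shift_left ker_shift_right)
      have "c * ker N x x \<le> c * (1 + 1 / real N)"
        using ker_self_le[OF x] N c by (intro mult_left_mono) auto
      then have "q x * q y = 1 - c * ker N x x" using c1 by (simp add: q_def K)
      then show ?thesis unfolding s using True K by (simp add: inner_prod_def)
    next
      case False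
      then show ?thesis unfolding s by (simp add: inner_prod_def c_def)
    qed
  qed
  then show ?thesis by blast
qed

section \<open>Cuts of the cube and the gap instance\<close>

lemma sum_edges:
  fixes g :: "'a set \<Rightarrow> real"
  assumes "finite V"
  shows "2 * (\<Sum>e\<in>edges V. g e) = (\<Sum>a\<in>V. \<Sum>b\<in>V - {a}. g {a, b})"
proof -
  have fin: "finite (edges V)" using assms by (simp add: edges_def)
  have "(\<Sum>a\<in>V. \<Sum>b\<in>V - {a}. g {a, b}) = (\<Sum>a\<in>V. \<Sum>e\<in>edges V. if a \<in> e then g e else 0)"
  proof (rule sum.cong[OF refl])
    fix a assume a: "a \<in> V"
    have "bij_betw (\<lambda>b. {a, b}) (V - {a}) {e \<in> edges V. a \<in> e}"
      unfolding bij_betw_def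
    proof
      show "inj_on (\<lambda>b. {a, b}) (V - {a})" by (auto simp: inj_on_def doubleton_eq_iff)
      show "(\<lambda>b. {a, b}) ` (V - {a}) = {e \<in> edges V. a \<in> e}"
      proof (intro equalityI subsetI)
        fix e assume "e \<in> (\<lambda>b. {a, b}) ` (V - {a})"
        then show "e \<in> {e \<in> edges V. a \<in> e}" using a by (auto simp: edges_def)
      next
        fix e assume "e \<in> {e \<in> edges V. a \<in> e}"
        then have "e \<subseteq> V" "card e = 2" "a \<in> e" by (auto simp: edges_def)
        then obtain x y where xy: "e = {x, y}" "x \<noteq> y" by (auto simp: card_2_iff)
        then have "e = {a, if a = x then y else x}" "(if a = x then y else x) \<in> V - {a}"
          using \<open>a \<in> e\<close> \<open>e \<subseteq> V\<close> by auto
        then show "e \<in> (\<lambda>b. {a, b}) ` (V - {a})" by blast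
      qed
    qed
    then have "(\<Sum>b\<in>V - {a}. g {a, b}) = (\<Sum>e | e \<in> edges V \<and> a \<in> e. g e)"
      by (rule sum.reindex_bij_betw)
    also have "\<dots> = (\<Sum>e\<in>edges V. if a \<in> e then g e else 0)"
      using fin by (simp add: sum.inter_filter)
    finally show "(\<Sum>b\<in>V - {a}. g {a, b}) = (\<Sum>e\<in>edges V. if a \<in> e then g e else 0)" .
  qed
  also have "\<dots> = (\<Sum>e\<in>edges V. \<Sum>a\<in>V. if a \<in> e then g e else 0)"
    by (rule sum.swap)
  also have "\<dots> = (\<Sum>e\<in>edges V. 2 * g e)"
  proof (rule sum.cong[OF refl])
    fix e assume "e \<in> edges V"
    then have "e \<subseteq> V" "card e = 2" by (auto simp: edges_def)
    moreover from this have "V \<inter> e = e" by blast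
    ultimately show "(\<Sum>a\<in>V. if a \<in> e then g e else 0) = 2 * g e"
      using assms by (simp add: sum.If_cases)
  qed
  finally show ?thesis by (simp add: sum_distrib_left)
qed

lemma sum_cut_edges:
  fixes g :: "'a set \<Rightarrow> real"
  assumes "S \<subseteq> V"
  shows "(\<Sum>e\<in>cut_edges V S. g e) = (\<Sum>a\<in>S. \<Sum>b\<in>V - S. g {a, b})"
proof -
  have "bij_betw (\<lambda>(a, b). {a, b}) (S \<times> (V - S)) (cut_edges V S)"
    unfolding bij_betw_def
  proof
    show "inj_on (\<lambda>(a, b). {a, b}) (S \<times> (V - S))"
      by (auto simp: inj_on_def doubleton_eq_iff)
    show "(\<lambda>(a, b). {a, b}) ` (S \<times> (V - S)) = cut_edges V S"
    proof (intro equalityI subsetI)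
      fix e assume "e \<in> (\<lambda>(a, b). {a, b}) ` (S \<times> (V - S))"
      then obtain a b where ab: "e = {a, b}" "a \<in> S" "b \<in> V" "b \<notin> S" by auto
      then have "e \<inter> S = {a}" "a \<noteq> b" by auto
      then show "e \<in> cut_edges V S" using ab assms by (auto simp: cut_edges_def edges_def)
    next
      fix e assume "e \<in> cut_edges V S"
      then have e: "e \<subseteq> V" "card e = 2" "card (e \<inter> S) = 1" by (auto simp: cut_edges_def edges_def)
      then obtain x y where xy: "e = {x, y}" "x \<noteq> y" by (auto simp: card_2_iff)
      obtain a where a: "e \<inter> S = {a}" using e(3) by (auto simp: card_1_singleton_iff)
      define b where "b = (if a = x then y else x)"
      have "e = {a, b}" "a \<noteq> b" using a xy by (auto simp: b_def)
      moreover from this have "b \<notin> S" using a by auto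
      ultimately show "e \<in> (\<lambda>(a, b). {a, b}) ` (S \<times> (V - S))"
        using a e(1) by auto
    qed
  qed
  from sum.reindex_bij_betw[OF this, of g] show ?thesis
    by (simp add: sum.cartesian_product case_prod_unfold)
qed

section \<open>Edge boundaries of shift-invariant sets\<close>

definition large :: "nat \<Rightarrow> bool" where
  "large m \<longleftrightarrow> 12 \<le> m \<and> 3 ^ (m div 8) * (real m * sqrt (real m / 2 ^ m)) \<le> 1 / 200
     \<and> 10 ^ 9 / 2 ^ m \<le> real m / 8000"

text \<open>The three clauses serve different places: 12 <= m gives 1/N <= 1/4096 for
  \<open>ker_triangle\<close>, the second one makes the low levels in \<open>kkl\<close> negligible
  for d = m div 8, the third bounds the loss to bad points. The second holds since 3^(m/8) <=
  2^(m/4) is beaten by the factor 2^(-m/2) inside the root.\<close>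

lemma eventually_large: "eventually large sequentially"
proof -
  have 1: "eventually (\<lambda>m. 2 powr (real m / 4) * (real m * sqrt (real m / 2 powr real m)) \<le> 1 / 200) sequentially"
    by real_asymp
  have 2: "eventually (\<lambda>m. 10 ^ 9 / 2 ^ m \<le> real m / 8000) sequentially"
    by real_asymp
  show ?thesis using 1 2 eventually_ge_at_top[of 12]
  proof eventually_elim
    case (elim m)
    have "(3::real) ^ (m div 8) \<le> 4 ^ (m div 8)" by (rule power_mono) auto
    also have "\<dots> = 2 powr (2 * real (m div 8))"
      by (simp add: powr_mult_base powr_realpow[symmetric] powr_powr[symmetric])
    also have "\<dots> \<le> 2 powr (real m / 4)"
    proof (rule powr_mono)
      have "8 * (m div 8) \<le> m" by simp
      then show "2 * real (m div 8) \<le> real m / 4" by linarith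
    qed simp
    finally have "3 ^ (m div 8) * (real m * sqrt (real m / 2 ^ m))
        \<le> 2 powr (real m / 4) * (real m * sqrt (real m / 2 powr real m))"
      by (intro mult_mono) (auto simp: powr_realpow)
    also note elim(1)
    finally show ?case unfolding large_def using elim(2,3) by blast
  qed
qed

text \<open>If the total influence were below m/2000, then, all influences being equal, each would
  be at most m/2^m. With d = m div 8 the low levels contribute at most 1/200 and the high ones at
  most 1/250, together less than the variance bound 1/72.\<close>

lemma edge_boundary_ge:
  fixes m :: nat
  defines "N \<equiv> 2 ^ m"
  assumes T: "T \<subseteq> Pow {..<N}" "\<And>x t. x \<in> T \<Longrightarrow> t < N \<Longrightarrow> shift t x \<in> T"
    and bal: "1 / 288 \<le> real (card T) * (2 ^ N - real (card T)) / (2 ^ N)\<^sup>2"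
    and m: "large m"
  shows "real m / 2000 * 2 ^ N \<le> (\<Sum>x\<in>Pow {..<N}. \<Sum>i<N. of_bool ((x \<in> T) \<noteq> (flip i x \<in> T)))"
proof -
  have N: "0 < N" by (simp add: N_def)
  define F where "F i x = (of_bool ((x \<in> T) \<noteq> (flip i x \<in> T)) :: real)" for i x
  define \<tau> where "\<tau> = avg N (F 0)"
  have inv: "shift t x \<in> T \<longleftrightarrow> x \<in> T" if "t < N" for x t
    using T(2)[of x t] T(2)[of "shift t x" t] that by auto
  have \<tau>: "avg N (F i) = \<tau>" if i: "i < N" for i
  proof -
    \<comment> \<open>Shifting by \<open>i\<close> carries coordinate \<open>i\<close> to coordinate
      0, so every influence equals that of coordinate 0.\<close>
    have "bij_betw (shift i) (Pow {..<N}) (Pow {..<N})"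
      by (rule bij_betw_byWitness[where f' = "shift i"])
        (use shift_subset[of i m] i in \<open>auto simp: N_def\<close>)
    then have "\<tau> = avg N (\<lambda>x. F 0 (shift i x))"
      unfolding \<tau>_def by (rule avg_bij[symmetric])
    also have "(\<lambda>x. F 0 (shift i x)) = F i"
    proof
      fix x
      have "flip 0 (shift i x) = shift i (flip i x)" by (simp add: shift_flip)
      then show "F 0 (shift i x) = F i x" by (simp add: F_def inv[OF i])
    qed
    finally show ?thesis ..
  qed
  have \<tau>0: "0 \<le> \<tau>" unfolding \<tau>_def by (intro avg_nonneg) (simp add: F_def)
  define \<mu> where "\<mu> = avg N (\<lambda>x. of_bool (x \<in> T))"
  have "\<mu> = real (card T) / 2 ^ N"
  proof -
    have "Pow {..<N} \<inter> T = T" using T by blast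
    then show ?thesis by (simp add: \<mu>_def avg_def of_bool_def sum.If_cases)
  qed
  then have "\<mu> - \<mu>\<^sup>2 = real (card T) * (2 ^ N - real (card T)) / (2 ^ N)\<^sup>2"
    by (simp add: power2_eq_square right_diff_distrib diff_divide_distrib)
  then have \<mu>: "1 / 72 \<le> 4 * (\<mu> - \<mu>\<^sup>2)" using bal by simp
  have *: "real m / 2000 \<le> real N * \<tau>"
  proof (rule ccontr)
    assume "\<not> ?thesis"
    then have less: "real N * \<tau> \<le> real m / 2000" by simp
    have m12: "12 \<le> m" and A: "3 ^ (m div 8) * (real m * sqrt (real m / 2 ^ m)) \<le> 1 / 200"
      using m by (auto simp: large_def)
    have "4 * (\<mu> - \<mu>\<^sup>2) \<le> real N * (3 ^ (m div 8) * (\<tau> * sqrt \<tau>)) + real N * \<tau> / (real (m div 8) + 1)"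
      unfolding \<mu>_def by (rule kkl) (use \<tau> in \<open>simp add: F_def[abs_def]\<close>)
    also have "real N * (3 ^ (m div 8) * (\<tau> * sqrt \<tau>)) = 3 ^ (m div 8) * (real N * \<tau> * sqrt \<tau>)"
      by (simp add: ac_simps)
    also have "\<dots> \<le> 3 ^ (m div 8) * (real m * sqrt (real m / 2 ^ m))"
    proof (intro mult_left_mono mult_mono)
      have "\<tau> * 2 ^ m \<le> real m" using less by (simp add: N_def mult.commute)
      then show "sqrt \<tau> \<le> sqrt (real m / 2 ^ m)" by (simp add: pos_le_divide_eq)
    qed (use less \<tau>0 in auto)
    also have "\<dots> \<le> 1 / 200" by (rule A)
    also have "real N * \<tau> / (real (m div 8) + 1) \<le> (real m / 2000) / (real m / 8)"
    proof (rule frac_le)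
      have "m \<le> 8 * (m div 8 + 1)" by presburger
      then show "real m / 8 \<le> real (m div 8) + 1" by linarith
    qed (use less m12 \<tau>0 in auto)
    also have "\<dots> = 1 / 250" using m12 by simp
    finally show False using \<mu> by simp
  qed
  have "(\<Sum>x\<in>Pow {..<N}. \<Sum>i<N. F i x) = avg N (\<lambda>x. \<Sum>i<N. F i x) * 2 ^ N"
    by (simp add: avg_def)
  also have "avg N (\<lambda>x. \<Sum>i<N. F i x) = real N * \<tau>"
    unfolding avg_sum using \<tau> by simp
  finally show ?thesis using * by (simp add: F_def mult_right_mono)
qed

section \<open>Cube edges between good points\<close>

definition adjacent :: "nat \<Rightarrow> nat set \<Rightarrow> nat set \<Rightarrow> bool" where
  "adjacent N x y \<longleftrightarrow> (\<exists>i<N. y = flip i x)"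

lemma adjacent_commute: "adjacent N x y \<longleftrightarrow> adjacent N y x"
  unfolding adjacent_def by (metis flip_flip)

lemma flip_neq: "flip i x \<noteq> x"
  using flip_iff[of i i x] by auto

lemma not_adjacent_self: "\<not> adjacent N x x"
  unfolding adjacent_def using flip_neq by metis

lemma flip_inj: "flip i x = flip j x \<Longrightarrow> i = j"
  using flip_iff[of i i x] flip_iff[of i j x] by (auto split: if_splits)

lemma sum_adjacent:
  assumes "finite A"
  shows "(\<Sum>y\<in>A. of_bool (adjacent N x y)) = (\<Sum>i<N. of_bool (flip i x \<in> A) :: real)"
proof -
  have "bij_betw (\<lambda>i. flip i x) {i. i < N \<and> flip i x \<in> A} {y \<in> A. adjacent N x y}"
    by (rule bij_betwI') (auto simp: adjacent_def dest: flip_inj)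
  then have "card {i. i < N \<and> flip i x \<in> A} = card {y \<in> A. adjacent N x y}"
    by (rule bij_betw_same_card)
  moreover have "{..<N} \<inter> {i. flip i x \<in> A} = {i. i < N \<and> flip i x \<in> A}"
    "A \<inter> {y. adjacent N x y} = {y \<in> A. adjacent N x y}" by auto
  ultimately show ?thesis using assms by (simp add: of_bool_def sum.If_cases)
qed

text \<open>Each boundary edge of the cube is seen from both ends, so counting only the edges that
  leave \<open>T\<close> keeps half of m/2000. Edges into bad points take at most half of the rest:
  N |bad| <= (m/8000) 2^N.\<close>

lemma invariant_cut_ge:
  fixes m :: nat
  defines "N \<equiv> 2 ^ m"
  assumes T: "T \<subseteq> good N" "\<And>x t. x \<in> T \<Longrightarrow> t < N \<Longrightarrow> shift t x \<in> T"
    and bal: "1 / 288 \<le> real (card T) * (2 ^ N - real (card T)) / (2 ^ N)\<^sup>2"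
    and m: "large m"
  shows "real m / 8000 * 2 ^ N \<le> (\<Sum>x\<in>T. \<Sum>y\<in>good N - T. of_bool (adjacent N x y))"
proof -
  have N: "0 < N" by (simp add: N_def)
  define P where "P = Pow {..<N}"
  define bad where "bad = P - good N"
  have fin: "finite P" "finite (good N)" "finite T" "finite bad"
  proof -
    show P: "finite P" by (simp add: P_def)
    show G: "finite (good N)" by (rule finite_subset[of _ P]) (auto simp: good_def P_def)
    show "finite T" by (rule finite_subset[OF T(1) G])
    show "finite bad" using P by (simp add: bad_def)
  qed
  have TP: "T \<subseteq> P" using T by (auto simp: good_def P_def)
  have flipP: "flip i x \<in> P \<longleftrightarrow> x \<in> P" if "i < N" for i x
    using flip_in_Pow[OF that] by (simp add: P_def)
  have reflip: "(\<Sum>x\<in>P. f (flip i x)) = (\<Sum>x\<in>P. f x)" if "i < N" for i and f :: "nat set \<Rightarrow> real"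
    using avg_flip[OF that, of f] by (simp add: avg_def P_def)
  have "real m / 2000 * 2 ^ N \<le> (\<Sum>x\<in>P. \<Sum>i<N. of_bool ((x \<in> T) \<noteq> (flip i x \<in> T)))"
    unfolding N_def P_def by (rule edge_boundary_ge) (use assms TP in \<open>auto simp: P_def N_def\<close>)
  also have "\<dots> = (\<Sum>i<N. \<Sum>x\<in>P. of_bool (x \<in> T \<and> flip i x \<notin> T) + of_bool (x \<notin> T \<and> flip i x \<in> T))"
    by (subst sum.swap) (intro sum.cong refl, auto)
  also have "\<dots> = (\<Sum>i<N. 2 * (\<Sum>x\<in>P. of_bool (x \<in> T \<and> flip i x \<notin> T)))"
  proof (rule sum.cong[OF refl])
    fix i assume "i \<in> {..<N}"
    then have "(\<Sum>x\<in>P. of_bool (x \<notin> T \<and> flip i x \<in> T)) = (\<Sum>x\<in>P. of_bool (x \<in> T \<and> flip i x \<notin> T) :: real)"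
      using reflip[of i "\<lambda>x. of_bool (x \<notin> T \<and> flip i x \<in> T)"] by (simp add: conj_commute)
    then show "(\<Sum>x\<in>P. of_bool (x \<in> T \<and> flip i x \<notin> T) + of_bool (x \<notin> T \<and> flip i x \<in> T))
        = 2 * (\<Sum>x\<in>P. of_bool (x \<in> T \<and> flip i x \<notin> T) :: real)"
      by (simp add: sum.distrib)
  qed
  finally have "real m / 4000 * 2 ^ N \<le> (\<Sum>i<N. \<Sum>x\<in>P. of_bool (x \<in> T \<and> flip i x \<notin> T))"
    by (simp add: sum_distrib_left[symmetric])
  also have "\<dots> \<le> (\<Sum>i<N. (\<Sum>x\<in>T. of_bool (flip i x \<in> good N - T)) + real (card bad))"
  proof (rule sum_mono)
    fix i assume i: "i \<in> {..<N}"
    have "(\<Sum>x\<in>P. of_bool (x \<in> T \<and> flip i x \<notin> T))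
        \<le> (\<Sum>x\<in>P. (if x \<in> T then of_bool (flip i x \<in> good N - T) else 0) + of_bool (flip i x \<in> bad) :: real)"
      using i flipP by (intro sum_mono) (auto simp: bad_def)
    also have "\<dots> = (\<Sum>x\<in>P. if x \<in> T then of_bool (flip i x \<in> good N - T) else 0) + (\<Sum>x\<in>P. of_bool (x \<in> bad))"
      using reflip[of i "\<lambda>x. of_bool (x \<in> bad)"] i by (simp add: sum.distrib)
    also have "(\<Sum>x\<in>P. if x \<in> T then of_bool (flip i x \<in> good N - T) else 0) = (\<Sum>x\<in>T. of_bool (flip i x \<in> good N - T) :: real)"
      using fin TP by (simp add: sum.inter_restrict[symmetric] Int_absorb1)
    also have "(\<Sum>x\<in>P. of_bool (x \<in> bad)) = real (card bad)"
    proof -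
      have "P \<inter> bad = bad" by (auto simp: bad_def)
      then show ?thesis using fin by (simp add: of_bool_def sum.If_cases)
    qed
    finally show "(\<Sum>x\<in>P. of_bool (x \<in> T \<and> flip i x \<notin> T))
        \<le> (\<Sum>x\<in>T. of_bool (flip i x \<in> good N - T)) + real (card bad)" .
  qed
  also have "\<dots> = (\<Sum>x\<in>T. \<Sum>i<N. of_bool (flip i x \<in> good N - T)) + real N * real (card bad)"
    unfolding sum.distrib by (subst sum.swap) simp
  also have "(\<Sum>x\<in>T. \<Sum>i<N. of_bool (flip i x \<in> good N - T)) = (\<Sum>x\<in>T. \<Sum>y\<in>good N - T. of_bool (adjacent N x y) :: real)"
    using sum_adjacent[of "good N - T"] fin by simp
  also have "real N * real (card bad) \<le> real N * (10 ^ 9 / (real N)\<^sup>2 * 2 ^ N)"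
    using card_bad_le[of m] by (intro mult_left_mono) (auto simp: bad_def P_def N_def)
  also have "\<dots> = 10 ^ 9 / real N * 2 ^ N"
    using N by (simp add: power2_eq_square)
  also have "\<dots> \<le> real m / 8000 * 2 ^ N"
    using m by (intro mult_right_mono) (auto simp: large_def N_def)
  finally show ?thesis by (simp add: field_simps)
qed

text \<open>\<open>set_encode\<close> yields an instance over \<open>nat\<close>; quantifying over
  both endpoints makes the weights functions of unordered edges. The heavy weight exceeds the cut
  value aimed at, and the balance is a sixth of the total demand, the least one allowed. The tiny
  weights add up to O(2^N), the order of the SDP value.\<close>

definition gap_instance :: "nat \<Rightarrow> nat separator_instance" where
  "gap_instance m = (let N = 2 ^ m; G = good N in
    \<lparr>verts = set_encode ` G,
     wt = (\<lambda>e. of_bool (\<exists>a\<in>e. \<exists>b\<in>e. adjacent N (set_decode a) (set_decode b))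
        + real m * 2 ^ N * of_bool (\<forall>a\<in>e. \<forall>b\<in>e. orbit N (set_decode a) = orbit N (set_decode b))
        + 1 / 2 ^ N),
     dem = (\<lambda>_. 1),
     bal = real (card G) * (real (card G) - 1) / 12\<rparr>)"

section \<open>Size, demands and cuts of the instance\<close>

context
  fixes m N :: nat and G :: "nat set set" and V :: "nat set"
  assumes large: "large m"
  defines "N \<equiv> 2 ^ m" and "G \<equiv> good N" and "V \<equiv> set_encode ` G"
begin

lemma m_ge: "12 \<le> m" and N_ge: "4096 \<le> N"
proof -
  show "12 \<le> m" using large by (simp add: large_def)
  then show "4096 \<le> N" using power_increasing[of 12 m "2::nat"] by (simp add: N_def)
qed

lemma G_subset: "G \<subseteq> Pow {..<N}"
  by (auto simp: G_def good_def)

lemma finite_G: "finite G"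
  by (rule finite_subset[OF G_subset]) simp

lemma finite_member: "x \<in> G \<Longrightarrow> finite x"
  using G_subset finite_subset[of x "{..<N}"] by auto

lemma decode_encode [simp]: "x \<in> G \<Longrightarrow> set_decode (set_encode x) = x"
  by (simp add: finite_member)

lemma inj_encode: "inj_on set_encode G"
  by (rule inj_on_inverseI[where g = set_decode]) simp

lemma finite_V: "finite V"
  by (simp add: V_def finite_G)

lemma card_V: "card V = card G"
  unfolding V_def by (rule card_image[OF inj_encode])

lemma sum_V: "(\<Sum>a\<in>V. f a) = (\<Sum>x\<in>G. f (set_encode x))"
  unfolding V_def by (simp add: sum.reindex[OF inj_encode])

lemma decode_V [simp]: "a \<in> V \<Longrightarrow> set_decode a \<in> G"
  by (auto simp: V_def)

lemma encode_in_V [simp]: "x \<in> G \<Longrightarrow> set_encode x \<in> V"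
  by (simp add: V_def)

lemma verts_gap [simp]: "verts (gap_instance m) = V"
  by (simp add: gap_instance_def Let_def V_def G_def N_def)

lemma dem_gap [simp]: "dem (gap_instance m) = (\<lambda>_. 1)"
  by (simp add: gap_instance_def Let_def)

lemma bal_gap: "bal (gap_instance m) = real (card G) * (real (card G) - 1) / 12"
  by (simp add: gap_instance_def Let_def G_def N_def)

lemma wt_gap: "wt (gap_instance m) {a, b} = of_bool (adjacent N (set_decode a) (set_decode b))
    + real m * 2 ^ N * of_bool (orbit N (set_decode a) = orbit N (set_decode b)) + 1 / 2 ^ N"
proof -
  have "(\<exists>x\<in>{a, b}. \<exists>y\<in>{a, b}. adjacent N (set_decode x) (set_decode y)) \<longleftrightarrow> adjacent N (set_decode a) (set_decode b)"
    using not_adjacent_self adjacent_commute by auto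
  moreover have "(\<forall>x\<in>{a, b}. \<forall>y\<in>{a, b}. orbit N (set_decode x) = orbit N (set_decode y))
      \<longleftrightarrow> orbit N (set_decode a) = orbit N (set_decode b)" by auto
  ultimately show ?thesis by (simp add: gap_instance_def Let_def N_def)
qed

lemma wt_gap_ge: "1 / 2 ^ N \<le> wt (gap_instance m) e"
  unfolding gap_instance_def Let_def N_def separator_instance.select_convs
  by (rule add_increasing) (intro add_nonneg_nonneg mult_nonneg_nonneg, simp_all)

lemma wt_gap_nonneg: "0 \<le> wt (gap_instance m) e"
  by (rule order_trans[OF _ wt_gap_ge]) simp

lemma card_G_le: "real (card G) \<le> 2 ^ N"
proof -
  have "card G \<le> card (Pow {..<N})" by (intro card_mono G_subset) simp
  then show ?thesis by (simp add: card_Pow)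
qed

lemma card_G_ge: "2 ^ N \<le> 2 * real (card G)"
proof -
  have "10 ^ 9 / (real N)\<^sup>2 \<le> 1 / 2"
  proof -
    have "m \<le> 2 ^ m" by (rule less_imp_le[OF less_exp])
    then have "m \<le> N" by (simp add: N_def)
    have "10 ^ 9 / (real N)\<^sup>2 = 10 ^ 9 / real N / real N" by (simp add: power2_eq_square)
    also have "\<dots> \<le> real m / 8000 / real N"
      using large by (intro divide_right_mono) (auto simp: large_def N_def)
    also have "\<dots> \<le> 1 / 2" using \<open>m \<le> N\<close> N_ge by (simp add: field_simps)
    finally show ?thesis .
  qed
  then have "10 ^ 9 / (real N)\<^sup>2 * 2 ^ N \<le> 1 / 2 * 2 ^ N"
    by (intro mult_right_mono) auto
  then have "real (card (Pow {..<N} - G)) \<le> 2 ^ N / 2"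
    using card_bad_le[of m] by (simp add: N_def G_def)
  moreover have "card (Pow {..<N}) = card (Pow {..<N} - G) + card G"
    using card_Diff_subset[OF finite_G G_subset] card_mono[OF _ G_subset] by simp
  then have "(2::real) ^ N = real (card (Pow {..<N} - G)) + real (card G)"
    by (simp add: card_Pow) (metis of_nat_add of_nat_numeral of_nat_power)
  ultimately show ?thesis by simp
qed

text \<open>Orbits have at most N points, so pairs inside an orbit are a small share of all pairs;
  this feeds the demand constraint.\<close>

lemma N_le_card: "8 * real N \<le> real (card G)"
proof -
  have "m - 1 < 2 ^ (m - 1)" by (rule less_exp)
  then have "2 * m \<le> 2 * 2 ^ (m - 1)" by linarith
  also have "\<dots> = N" using m_ge by (simp add: N_def power_Suc[symmetric] del: power_Suc)
  finally have "4 + m \<le> N" using m_ge by linarith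
  then have "(2::real) ^ (4 + m) \<le> 2 ^ N" by (rule power_increasing) simp
  then have "16 * real N \<le> 2 ^ N" by (simp add: power_add N_def)
  then show ?thesis using card_G_ge by linarith
qed

lemma card_G_pos: "2 \<le> real (card G)"
  using N_le_card N_ge by simp

lemma bal_pos: "0 < bal (gap_instance m)"
  unfolding bal_gap using card_G_pos by simp

lemma total_dem_gap: "total_dem (gap_instance m) = 6 * bal (gap_instance m)"
proof -
  have "2 * total_dem (gap_instance m) = (\<Sum>a\<in>V. \<Sum>b\<in>V - {a}. 1)"
    unfolding total_dem_def verts_gap using sum_edges[OF finite_V, of "dem (gap_instance m)"] by simp
  also have "\<dots> = real (card G) * (real (card G) - 1)"
    using finite_V card_G_pos by (simp add: card_Diff_singleton card_V of_nat_diff)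
  finally show ?thesis by (simp add: bal_gap)
qed

lemma balanced_gap: "balanced_edge_separator (gap_instance m)"
  unfolding balanced_edge_separator_def total_dem_gap
  using bal_pos by (simp add: finite_V wt_gap_nonneg)

lemma cut_dem:
  assumes "S \<subseteq> V"
  shows "(\<Sum>e\<in>cut_edges V S. dem (gap_instance m) e) = real (card S) * (real (card G) - real (card S))"
proof -
  have "finite S" using assms finite_V by (rule finite_subset)
  then have "card (V - S) = card G - card S" "card S \<le> card G"
    using assms card_mono[OF finite_V assms] by (simp_all add: card_Diff_subset card_V)
  then show ?thesis
    unfolding sum_cut_edges[OF assms] by (simp add: of_nat_diff)
qed

text \<open>The minimum in \<open>cut_opt\<close> must range over a nonempty set. Halving the
  vertices separates about half of the total demand, far above the required eighteenth.\<close>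

lemma balanced_cut_exists: "\<exists>S. balanced_cut (gap_instance m) (bal (gap_instance m) / 3) S"
proof -
  define k where "k = card G div 2"
  have "k \<le> card V" by (simp add: k_def card_V)
  then obtain S where S: "S \<subseteq> V" "card S = k" using obtain_subset_with_card_n by metis
  have k: "real (card G) - 1 \<le> 2 * real k" "2 * real k \<le> real (card G)" "1 \<le> k"
    using card_G_pos unfolding k_def by linarith+
  have "(real (card G) - 1) / 2 * (real (card G) / 2) \<le> real k * (real (card G) - real k)"
    using k card_G_pos by (intro mult_mono) auto
  moreover have "0 \<le> real (card G) * (real (card G) - 1)" using card_G_pos by simp
  ultimately have d: "bal (gap_instance m) / 3 \<le> real k * (real (card G) - real k)"
    by (simp add: bal_gap mult.commute)
  have "S \<noteq> {}" using S k by auto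
  moreover have "S \<noteq> V" using S k card_V card_G_pos by auto
  ultimately have "balanced_cut (gap_instance m) (bal (gap_instance m) / 3) S"
    unfolding balanced_cut_def nontrivial_cut_def verts_gap
    using S d cut_dem[OF S(1)] by auto
  then show ?thesis by blast
qed

text \<open>A cut that separates an orbit pays the heavy weight; any other cut lifts to a shift-invariant
  subset of the cube.\<close>
lemma balanced_cut_ge:
  assumes "balanced_cut (gap_instance m) (bal (gap_instance m) / 3) S"
  shows "real m / 8000 * 2 ^ N \<le> (\<Sum>e\<in>cut_edges V S. wt (gap_instance m) e)"
proof -
  have S: "S \<subseteq> V" and d: "bal (gap_instance m) / 3 \<le> real (card S) * (real (card G) - real (card S))"
    using assms cut_dem[of S] by (auto simp: balanced_cut_def nontrivial_cut_def)
  have finS: "finite S" using S finite_V by (rule finite_subset)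
  show ?thesis
  proof (cases "\<exists>a\<in>S. \<exists>b\<in>V - S. orbit N (set_decode a) = orbit N (set_decode b)")
    case True
    then obtain a b where ab: "a \<in> S" "b \<in> V - S" "orbit N (set_decode a) = orbit N (set_decode b)"
      by blast
    have "real m / 8000 * 2 ^ N \<le> wt (gap_instance m) {a, b}"
      unfolding wt_gap using ab by simp
    also have "\<dots> \<le> (\<Sum>b\<in>V - S. wt (gap_instance m) {a, b})"
      using ab finite_V wt_gap_nonneg by (intro member_le_sum) auto
    also have "\<dots> \<le> (\<Sum>a\<in>S. \<Sum>b\<in>V - S. wt (gap_instance m) {a, b})"
      using ab finS wt_gap_nonneg by (intro member_le_sum) (auto intro: sum_nonneg)
    finally show ?thesis by (simp add: sum_cut_edges[OF S])
  next
    case False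
    define T where "T = set_decode ` S"
    have TG: "T \<subseteq> G" using S by (auto simp: T_def)
    have ST: "S = set_encode ` T" by (simp add: T_def image_image)
    have cT: "card T = card S"
      unfolding ST by (rule card_image[symmetric]) (use inj_encode TG inj_on_subset in blast)
    have VS: "V - S = set_encode ` (G - T)"
      unfolding V_def ST using inj_on_image_set_diff[OF inj_encode, of G T] TG by auto
    have inv: "shift t x \<in> T" if "x \<in> T" "t < N" for x t
    proof (rule ccontr)
      assume n: "shift t x \<notin> T"
      have x: "x \<in> G" "shift t x \<in> G"
        using that TG good_shift[of t m x] by (auto simp: G_def N_def)
      then have "set_encode x \<in> S" "set_encode (shift t x) \<in> V - S"
        using n that unfolding VS by (auto simp: ST)
      moreover have "orbit N (shift t x) = orbit N x"
        using that(2) orbit_shift[of t m x] by (simp add: N_def)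
      ultimately show False using False x by force
    qed
    \<comment> \<open>With g = card G the required demand is g(g-1)/36; replacing 2^N by 2g costs a
      factor 4 and g by 2(g-1) a factor 2, so 288 = 36 * 4 * 2.\<close>
    have "1 / 288 \<le> real (card T) * (2 ^ N - real (card T)) / (2 ^ N)\<^sup>2"
    proof -
      have "(2 ^ N)\<^sup>2 \<le> (2 * real (card G)) * (2 * real (card G))"
        unfolding power2_eq_square by (intro mult_mono card_G_ge) auto
      also have "\<dots> \<le> 8 * (real (card G) * (real (card G) - 1))"
      proof -
        have "2 * real (card G) \<le> real (card G) * real (card G)"
          using card_G_pos by (intro mult_right_mono) auto
        then show ?thesis by (simp add: algebra_simps)
      qed
      also have "\<dots> = 288 * (bal (gap_instance m) / 3)" by (simp add: bal_gap)
      also have "\<dots> \<le> 288 * (real (card T) * (real (card G) - real (card T)))"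
        using d by (simp add: cT)
      also have "\<dots> \<le> 288 * (real (card T) * (2 ^ N - real (card T)))"
        using card_G_le by (intro mult_left_mono) auto
      finally show ?thesis by (simp add: field_simps)
    qed
    then have "real m / 8000 * 2 ^ N \<le> (\<Sum>x\<in>T. \<Sum>y\<in>G - T. of_bool (adjacent N x y))"
      using invariant_cut_ge[of T m] TG inv large unfolding N_def G_def by blast
    also have "\<dots> \<le> (\<Sum>x\<in>T. \<Sum>y\<in>G - T. wt (gap_instance m) {set_encode x, set_encode y})"
      using TG by (intro sum_mono) (auto simp: wt_gap subset_iff)
    also have "\<dots> = (\<Sum>a\<in>S. \<Sum>b\<in>V - S. wt (gap_instance m) {a, b})"
    proof -
      have "inj_on set_encode T" "inj_on set_encode (G - T)"
        using inj_encode TG inj_on_subset by blast+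
      then show ?thesis unfolding VS unfolding ST by (simp add: sum.reindex)
    qed
    finally show ?thesis by (simp add: sum_cut_edges[OF S])
  qed
qed

lemma cut_opt_ge: "real m / 8000 * 2 ^ N \<le> cut_opt (gap_instance m)"
proof -
  let ?C = "{\<Sum>e\<in>cut_edges V S. wt (gap_instance m) e | S. balanced_cut (gap_instance m) (bal (gap_instance m) / 3) S}"
  have "?C \<subseteq> (\<lambda>S. \<Sum>e\<in>cut_edges V S. wt (gap_instance m) e) ` Pow V"
    by (auto simp: balanced_cut_def nontrivial_cut_def)
  then have "finite ?C" by (rule finite_subset) (simp add: finite_V)
  moreover have "?C \<noteq> {}" using balanced_cut_exists by auto
  ultimately have "Min ?C \<in> ?C" by (rule Min_in)
  then show ?thesis unfolding cut_opt_def verts_gap using balanced_cut_ge by auto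
qed

section \<open>The value of the SDP\<close>

lemma sum_inner_prod_le:
  "(\<Sum>x\<in>G. \<Sum>y\<in>G. inner_prod N x y) \<le> 2 / 3 * (real (card G) * (real (card G) - 1))"
proof -
  let ?g = "real (card G)"
  have N0: "0 < N" using N_ge by simp
  have orb: "(\<Sum>y\<in>G. of_bool (orbit N x = orbit N y)) \<le> real N" for x
  proof -
    have "{y \<in> G. orbit N x = orbit N y} \<subseteq> orbit N x"
      using self_in_orbit[OF N0] by auto
    then have "card {y \<in> G. orbit N x = orbit N y} \<le> card (orbit N x)"
      by (rule card_mono[rotated]) (simp add: orbit_def)
    also have "\<dots> \<le> N" unfolding orbit_def using card_image_le[of "{..<N}"] by simp
    finally show ?thesis using finite_G by (simp add: of_bool_def sum.If_cases Int_def)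
  qed
  have "(\<Sum>x\<in>G. \<Sum>y\<in>G. inner_prod N x y) \<le> (\<Sum>x\<in>G. \<Sum>y\<in>G. of_bool (orbit N x = orbit N y) + ker N x y)"
  proof (intro sum_mono)
    fix x y
    have "(1 - 2 / real N) * ker N x y \<le> 1 * ker N x y" by (intro mult_right_mono) auto
    then show "inner_prod N x y \<le> of_bool (orbit N x = orbit N y) + ker N x y"
      by (simp add: inner_prod_def)
  qed
  also have "\<dots> = (\<Sum>x\<in>G. \<Sum>y\<in>G. of_bool (orbit N x = orbit N y)) + (\<Sum>y\<in>G. \<Sum>x\<in>G. ker N x y)"
    by (simp add: sum.distrib) (rule sum.swap)
  also have "(\<Sum>x\<in>G. \<Sum>y\<in>G. of_bool (orbit N x = orbit N y)) \<le> (\<Sum>x\<in>G. real N)"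
    by (intro sum_mono orb)
  also have "(\<Sum>y\<in>G. \<Sum>x\<in>G. ker N x y) \<le> (\<Sum>y\<in>G. 2 ^ N * (9 / real N))"
  proof (rule sum_mono)
    fix y
    have "(\<Sum>x\<in>G. ker N x y) \<le> (\<Sum>x\<in>Pow {..<N}. ker N x y)"
      by (rule sum_mono2) (use G_subset in auto)
    also have "\<dots> = 2 ^ N * avg N (\<lambda>x. ker N x y)" by (simp add: avg_def)
    also have "\<dots> \<le> 2 ^ N * (9 / real N)"
      using avg_ker_le[OF N0] by (intro mult_left_mono) auto
    finally show "(\<Sum>x\<in>G. ker N x y) \<le> 2 ^ N * (9 / real N)" .
  qed
  also have "(\<Sum>x\<in>G. real N) + (\<Sum>y\<in>G. 2 ^ N * (9 / real N)) = ?g * (real N + 2 ^ N * (9 / real N))"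
    by (simp add: distrib_left)
  \<comment> \<open>The target 2/3 suffices for the demand constraint, where a quarter of g^2 minus
    this sum must reach g(g-1)/12. The two terms in the bracket are at most g/8 and g/200.\<close>
  also have "\<dots> \<le> ?g * (2 / 3 * (?g - 1))"
  proof (rule mult_left_mono)
    have "2 ^ N * (9 / real N) \<le> (2 * ?g) * (9 / 4096)"
      by (intro mult_mono frac_le) (use card_G_ge N_ge in auto)
    moreover have "n + q \<le> 2 / 3 * (g - 1)" if "q \<le> 2 * g * (9 / 4096)" "8 * n \<le> g" "4096 \<le> n" for n q g :: real
      using that by simp
    ultimately show "real N + 2 ^ N * (9 / real N) \<le> 2 / 3 * (?g - 1)"
      using N_le_card N_ge by simp
  qed simp
  finally show ?thesis by (simp add: algebra_simps)
qed

lemma inner_prod_adjacent: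
  assumes "adjacent N x y"
  shows "1 - 130 / real N \<le> inner_prod N x y"
proof (cases "orbit N x = orbit N y")
  case False
  obtain i where i: "i < N" "y = flip i x" using assms by (auto simp: adjacent_def)
  have "(1 - a) * (1 - b) = 1 - (a + b) + a * b" for a b :: real
    by (simp add: algebra_simps)
  moreover have "130 / real N = 2 / real N + 128 / real N"
    by (simp add: add_divide_distrib[symmetric])
  ultimately have "1 - 130 / real N \<le> (1 - 2 / real N) * (1 - 128 / real N)"
    by simp
  also have "\<dots> \<le> (1 - 2 / real N) * ker N x y"
    using ker_flip_ge[OF i(1), of x] N_ge i by (intro mult_left_mono) auto
  finally show ?thesis using False by (simp add: inner_prod_def)
qed (simp add: inner_prod_def)

lemma inner_prod_nonneg: "0 \<le> inner_prod N x y"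
  using N_ge by (simp add: inner_prod_def)

lemma sdp_solution: "\<exists>d v. sdp_feasible (gap_instance m) d v \<and> sdp_objective (gap_instance m) d v \<le> 33 * 2 ^ N"
proof -
  obtain d :: nat and u where u: "\<forall>x\<in>G. \<forall>y\<in>G. inner_prod N x y = (\<Sum>i<d. u x i * u y i)"
    using inner_prod_vectors[of m] m_ge unfolding G_def N_def by auto
  define v where "v a = u (set_decode a)" for a
  have self: "inner_prod N x x = 1" for x by (simp add: inner_prod_def)
  have sq_norm: "sq_norm d w = (\<Sum>i<d. (w i)\<^sup>2)" for w
    unfolding sq_norm_def L2_set_def by (simp add: sum_nonneg)
  have dist: "sq_dist d v a b = 2 - 2 * inner_prod N (set_decode a) (set_decode b)" if "a \<in> V" "b \<in> V" for a b
  proof -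
    let ?x = "set_decode a" and ?y = "set_decode b"
    have "sq_dist d v a b = (\<Sum>i<d. u ?x i * u ?x i + u ?y i * u ?y i - 2 * (u ?x i * u ?y i))"
      unfolding sq_dist_def sq_norm v_def by (simp add: power2_eq_square algebra_simps)
    also have "\<dots> = inner_prod N ?x ?x + inner_prod N ?y ?y - 2 * inner_prod N ?x ?y"
      using u that by (simp add: sum.distrib sum_subtractf sum_distrib_left)
    finally show ?thesis by (simp add: self)
  qed
  have dist0: "0 \<le> sq_dist d v a b" for a b
    by (simp add: sq_dist_def sq_norm sum_nonneg)
  have le1: "inner_prod N (set_decode a) (set_decode b) \<le> 1" if "a \<in> V" "b \<in> V" for a b
    using dist[OF that] dist0[of a b] by simp
  have "sdp_feasible (gap_instance m) d v"
    unfolding sdp_feasible_def verts_gap dem_gap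
  proof (intro conjI ballI)
    fix a assume "a \<in> V"
    then show "sq_norm d (v a) = 1"
      using u self[of "set_decode a"] by (simp add: sq_norm v_def power2_eq_square)
  next
    fix a b c assume abc: "a \<in> V" "b \<in> V" "c \<in> V"
    have "inner_prod N (set_decode a) (set_decode b) + inner_prod N (set_decode b) (set_decode c)
        \<le> 1 + inner_prod N (set_decode a) (set_decode c)"
      unfolding N_def
      by (rule inner_prod_triangle) (use abc le1 m_ge decode_V[of b] in \<open>simp_all add: N_def G_def\<close>)
    then show "sq_dist d v a c \<le> sq_dist d v a b + sq_dist d v b c"
      by (simp add: dist abc)
  next
    have "2 * (\<Sum>e\<in>edges V. 1 * edge_sq_dist d v e) = (\<Sum>a\<in>V. \<Sum>b\<in>V - {a}. sq_dist d v a b)"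
      using sum_edges[OF finite_V, of "edge_sq_dist d v"] by simp
    also have "\<dots> = (\<Sum>a\<in>V. \<Sum>b\<in>V. sq_dist d v a b)"
    proof (rule sum.cong[OF refl])
      fix a assume a: "a \<in> V"
      then have "sq_dist d v a a = 0" by (simp add: dist self)
      then show "(\<Sum>b\<in>V - {a}. sq_dist d v a b) = (\<Sum>b\<in>V. sq_dist d v a b)"
        using a finite_V by (simp add: sum.remove[of V a])
    qed
    also have "\<dots> = (\<Sum>a\<in>V. \<Sum>b\<in>V. 2 - 2 * inner_prod N (set_decode a) (set_decode b))"
      by (intro sum.cong refl dist)
    also have "\<dots> = (\<Sum>x\<in>G. \<Sum>y\<in>G. 2 - 2 * inner_prod N x y)"
      by (simp add: sum_V cong: sum.cong)
    also have "\<dots> = 2 * (real (card G) * real (card G)) - 2 * (\<Sum>x\<in>G. \<Sum>y\<in>G. inner_prod N x y)"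
      by (simp add: sum_subtractf sum_distrib_left)
    finally have "(\<Sum>e\<in>edges V. 1 * edge_sq_dist d v e)
        = real (card G) * real (card G) - (\<Sum>x\<in>G. \<Sum>y\<in>G. inner_prod N x y)" by simp
    moreover have "0 \<le> real (card G)" by simp
    ultimately show "bal (gap_instance m) \<le> 1 / 4 * (\<Sum>e\<in>edges V. 1 * edge_sq_dist d v e)"
      using sum_inner_prod_le by (simp add: bal_gap algebra_simps)
  qed
  moreover have "sdp_objective (gap_instance m) d v \<le> 33 * 2 ^ N"
  proof -
    have "2 * (\<Sum>e\<in>edges V. wt (gap_instance m) e * edge_sq_dist d v e)
        = (\<Sum>a\<in>V. \<Sum>b\<in>V - {a}. wt (gap_instance m) {a, b} * sq_dist d v a b)"
      using sum_edges[OF finite_V, of "\<lambda>e. wt (gap_instance m) e * edge_sq_dist d v e"] by simp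
    also have "\<dots> \<le> (\<Sum>a\<in>V. \<Sum>b\<in>V. wt (gap_instance m) {a, b} * sq_dist d v a b)"
      using finite_V wt_gap_nonneg dist0 by (intro sum_mono sum_mono2) auto
    also have "\<dots> \<le> (\<Sum>a\<in>V. \<Sum>b\<in>V. 260 / real N * of_bool (adjacent N (set_decode a) (set_decode b)) + 2 / 2 ^ N)"
    proof (intro sum_mono)
      fix a b assume ab: "a \<in> V" "b \<in> V"
      let ?x = "set_decode a" and ?y = "set_decode b"
      let ?D = "2 - 2 * inner_prod N ?x ?y"
      have wt: "wt (gap_instance m) {a, b} * sq_dist d v a b = of_bool (adjacent N ?x ?y) * ?D
          + real m * 2 ^ N * (of_bool (orbit N ?x = orbit N ?y) * ?D) + 1 / 2 ^ N * ?D"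
        unfolding dist[OF ab] wt_gap distrib_right by (simp only: mult.assoc)
      have "of_bool (orbit N ?x = orbit N ?y) * ?D = 0" by (simp add: inner_prod_def)
      then have "real m * 2 ^ N * (of_bool (orbit N ?x = orbit N ?y) * ?D) = 0" by (simp only: mult_zero_right)
      moreover have "of_bool (adjacent N ?x ?y) * ?D \<le> 260 / real N * of_bool (adjacent N ?x ?y)"
        using inner_prod_adjacent[of ?x ?y] by auto
      moreover have "1 / 2 ^ N * ?D \<le> 2 / 2 ^ N"
        using inner_prod_nonneg[of ?x ?y] by (simp add: divide_right_mono)
      ultimately show "wt (gap_instance m) {a, b} * sq_dist d v a b
          \<le> 260 / real N * of_bool (adjacent N ?x ?y) + 2 / 2 ^ N"
        unfolding wt by linarith
    qed
    also have "\<dots> = (\<Sum>x\<in>G. \<Sum>y\<in>G. 260 / real N * of_bool (adjacent N x y) + 2 / 2 ^ N)"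
      by (simp add: sum_V cong: sum.cong)
    \<comment> \<open>A vertex has at most N neighbours at 260/N each and at most 2^N tiny weights
      at 2/2^N each. Ordered pairs count edges twice and the objective carries 1/4, so 262/8 < 33 is
      the final constant.\<close>
    also have "\<dots> \<le> (\<Sum>x\<in>G. 262)"
    proof (rule sum_mono)
      fix x
      have "(\<Sum>y\<in>G. of_bool (adjacent N x y)) \<le> (\<Sum>i<N. 1 :: real)"
        unfolding sum_adjacent[OF finite_G] by (intro sum_mono) simp
      then have "260 / real N * (\<Sum>y\<in>G. of_bool (adjacent N x y)) \<le> 260 / real N * real N"
        by (intro mult_left_mono) auto
      moreover have "real (card G) * (2 / 2 ^ N) \<le> 2 ^ N * (2 / 2 ^ N)"
        by (intro mult_right_mono card_G_le) simp
      moreover have "260 / real N * real N = 260" "(2::real) ^ N * (2 / 2 ^ N) = 2"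
        using N_ge by simp_all
      ultimately show "(\<Sum>y\<in>G. 260 / real N * of_bool (adjacent N x y) + 2 / 2 ^ N) \<le> 262"
        unfolding sum.distrib sum_distrib_left[symmetric] sum_constant by linarith
    qed
    also have "\<dots> \<le> 262 * 2 ^ N" using card_G_le by simp
    finally have "2 * (\<Sum>e\<in>edges V. wt (gap_instance m) e * edge_sq_dist d v e) \<le> 262 * 2 ^ N" .
    moreover have "(0::real) \<le> 2 ^ N" by simp
    ultimately show ?thesis unfolding sdp_objective_def verts_gap by linarith
  qed
  ultimately show ?thesis by blast
qed

text \<open>Every weight is at least 2^(-N) and every demand is 1, so the objective dominates the
  demand constraint scaled by 2^(-N). The bound is crude; it serves to make the infimum
  positive.\<close>

lemma sdp_objective_ge:
  assumes "sdp_feasible (gap_instance m) d v"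
  shows "bal (gap_instance m) / 2 ^ N \<le> sdp_objective (gap_instance m) d v"
proof -
  have "0 \<le> edge_sq_dist d v e" if "e \<in> edges V" for e
  proof -
    have "card e = 2" using that by (simp add: edges_def)
    then obtain x y where "e = {x, y}" by (auto simp: card_2_iff)
    then show ?thesis by (simp add: sq_dist_def sq_norm_def)
  qed
  then have "1 / 2 ^ N * (\<Sum>e\<in>edges V. edge_sq_dist d v e) \<le> (\<Sum>e\<in>edges V. wt (gap_instance m) e * edge_sq_dist d v e)"
    unfolding sum_distrib_left by (intro sum_mono mult_right_mono wt_gap_ge)
  moreover have "bal (gap_instance m) \<le> 1 / 4 * (\<Sum>e\<in>edges V. edge_sq_dist d v e)"
    using assms by (simp add: sdp_feasible_def)
  then have "bal (gap_instance m) / 2 ^ N \<le> 1 / 4 * (\<Sum>e\<in>edges V. edge_sq_dist d v e) / 2 ^ N"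
    by (rule divide_right_mono) simp
  then have "bal (gap_instance m) / 2 ^ N \<le> 1 / 4 * (1 / 2 ^ N * (\<Sum>e\<in>edges V. edge_sq_dist d v e))"
    by simp
  ultimately show ?thesis
    unfolding sdp_objective_def verts_gap by linarith
qed

lemma sdp_opt_pos: "0 < sdp_opt (gap_instance m)"
  and sdp_opt_le: "sdp_opt (gap_instance m) \<le> 33 * 2 ^ N"
proof -
  let ?O = "{sdp_objective (gap_instance m) d v | d v. sdp_feasible (gap_instance m) d v}"
  obtain d v where dv: "sdp_feasible (gap_instance m) d v" "sdp_objective (gap_instance m) d v \<le> 33 * 2 ^ N"
    using sdp_solution by blast
  have "bal (gap_instance m) / 2 ^ N \<le> Inf ?O"
    by (rule cInf_greatest) (use dv sdp_objective_ge in blast)+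
  moreover have "0 < bal (gap_instance m) / 2 ^ N" using bal_pos by simp
  ultimately show "0 < sdp_opt (gap_instance m)" unfolding sdp_opt_def by linarith
  have "Inf ?O \<le> sdp_objective (gap_instance m) d v"
  proof (rule cInf_lower)
    show "bdd_below ?O" unfolding bdd_below_def using sdp_objective_ge by blast
  qed (use dv in blast)
  then show "sdp_opt (gap_instance m) \<le> 33 * 2 ^ N"
    unfolding sdp_opt_def using dv by linarith
qed

lemma integrality_gap_ge: "real m / 264000 \<le> integrality_gap (gap_instance m)"
proof -
  have "real m / 264000 = (real m / 8000 * 2 ^ N) / (33 * 2 ^ N)" by simp
  also have "\<dots> \<le> cut_opt (gap_instance m) / sdp_opt (gap_instance m)"
  proof (rule frac_le)
    show "0 \<le> cut_opt (gap_instance m)" by (rule order_trans[OF _ cut_opt_ge]) simp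
  qed (rule cut_opt_ge sdp_opt_pos sdp_opt_le)+
  finally show ?thesis by (simp add: integrality_gap_def)
qed

lemma card_verts_le: "card (verts (gap_instance m)) \<le> 2 ^ 2 ^ m"
proof -
  have "real (card V) \<le> real (2 ^ N)" using card_G_le by (simp add: card_V)
  then show ?thesis unfolding verts_gap N_def by (simp only: of_nat_le_iff)
qed

end

section \<open>Choice of the parameter for a given number of vertices\<close>

theorem theorem1p1:
  fixes \<delta> :: real
  assumes "\<delta> > 0"
  shows "\<exists>n0::nat. \<forall>n\<ge>n0. \<exists>I :: nat separator_instance.
    balanced_edge_separator I \<and> card (verts I) \<le> n \<and> sdp_opt I > 0 \<and>
    integrality_gap I \<ge> (log 2 (log 2 (real n))) powr (1 / 6 - \<delta>)"
proof -
  \<comment> \<open>The gap is linear in m, which beats the exponent 1/6 whatever the constant; the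
    + 1 absorbs rounding log log n down to m.\<close>
  have "eventually (\<lambda>m. (real m + 1) powr (1 / 6) \<le> real m / 264000) sequentially"
    by real_asymp
  then have "eventually (\<lambda>m. large m \<and> (real m + 1) powr (1 / 6) \<le> real m / 264000) sequentially"
    using eventually_large by (rule eventually_conj[rotated])
  then obtain m0 where m0: "\<And>m. m0 \<le> m \<Longrightarrow> large m \<and> (real m + 1) powr (1 / 6) \<le> real m / 264000"
    unfolding eventually_sequentially by blast
  show ?thesis
  \<comment> \<open>The \<open>m0 + 1\<close> keeps log log n at least 1, so lowering the exponent
    by \<delta> cannot increase the power, even if the exponent becomes negative.\<close>
  proof (intro exI[of _ "2 ^ 2 ^ (m0 + 1)"] allI impI)
    fix n :: nat assume n: "2 ^ 2 ^ (m0 + 1) \<le> n"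
    define L where "L = log 2 (real n)"
    have "real (2 ^ 2 ^ (m0 + 1)) \<le> real n" using n by (rule of_nat_mono)
    then have "(2::real) ^ 2 ^ (m0 + 1) \<le> real n" by simp
    moreover from this have npos: "0 < real n" by (rule less_le_trans[rotated]) simp
    ultimately have "real (2 ^ (m0 + 1)) \<le> L"
      unfolding L_def by (intro le_log_of_power) auto
    then have L: "2 ^ (m0 + 1) \<le> L" by simp
    then have Lpos: "0 < L" by (rule less_le_trans[rotated]) simp
    have LL: "real (m0 + 1) \<le> log 2 L"
      using L by (rule le_log_of_power) simp
    define m where "m = nat \<lfloor>log 2 L\<rfloor>"
    have m: "real m \<le> log 2 L" "log 2 L \<le> real m + 1" "m0 \<le> m"
      using LL unfolding m_def by linarith+
    have lm: "large m" and gm: "(real m + 1) powr (1 / 6) \<le> real m / 264000"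
      using m0[OF m(3)] by auto
    have "2 ^ m \<le> L" using m(1) Lpos by (simp add: le_log_iff powr_realpow)
    then have "real (2 ^ m) \<le> log 2 (real n)" by (simp add: L_def)
    then have "2 powr real (2 ^ m) \<le> real n" using npos by (subst (asm) le_log_iff) auto
    also have "2 powr real (2 ^ m) = real (2 ^ 2 ^ m)" by (subst powr_realpow) auto
    finally have "2 ^ 2 ^ m \<le> n" by (simp only: of_nat_le_iff)
    then have card: "card (verts (gap_instance m)) \<le> n"
      using card_verts_le[OF lm] by linarith
    have "log 2 L powr (1 / 6 - \<delta>) \<le> log 2 L powr (1 / 6)"
      using LL assms by (intro powr_mono) auto
    also have "\<dots> \<le> (real m + 1) powr (1 / 6)"
      using m LL by (intro powr_mono2) auto
    also have "\<dots> \<le> integrality_gap (gap_instance m)"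
      using gm integrality_gap_ge[OF lm] by linarith
    finally show "\<exists>I :: nat separator_instance.
        balanced_edge_separator I \<and> card (verts I) \<le> n \<and> sdp_opt I > 0 \<and>
        integrality_gap I \<ge> (log 2 (log 2 (real n))) powr (1 / 6 - \<delta>)"
      using balanced_gap[OF lm] sdp_opt_pos[OF lm] card unfolding L_def by blast
  qed
qed

end
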